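(* There exist positive constants $b$ and $c$ such that for every integer $n\ge 1$ and every cubature formula of degree $2n$ with positive weights $(\lambda_\alpha)_{\alpha\in A}$ and nodes $(x_\alpha)_{\alpha\in A}\subset B^2$ on the unit disk $B^2$ with respect to the standard Lebesgue measure, the hyperinterpolation operator of degree $n$ $$\mathcal{L}_n(f)(\mathbf{x})=\sum_{\alpha\in A}\lambda_\alpha\,\mathbf{K}_n(x_\alpha,\mathbf{x})\,f(x_\alpha),\qquad f\in C(B^2),$$ satisfies $$b\,n\le\|\mathcal{L}_n\|\le c\,n .$$
   Context: $B^2=\{\mathbf{x}\in\mathbb{R}^2:\|\mathbf{x}\|\le 1\}$, and $C(B^2)$ is the space of continuous real functions on $B^2$ with the uniform norm $\|\cdot\|_{C(B^2)}$. $\Pi_n^2$ is the space of polynomials in two real variables of total degree at most $n$. A cubature formula of degree $N$ on $B^2$ with respect to Lebesgue measure consists of positive weights $\lambda_\alpha>0$ and nodes $x_\alpha\in B^2$, with $\alpha$ in a finite index set $A$, such that $\sum_{\alpha\in A}\lambda_\alpha f(x_\alpha)=\int_{B^2}f(\mathbf{x})\,d\mathbf{x}$ for all polynomials $f$ of total degree at most $N$. $\mathbf{K}_n(\cdot,\cdot)$ is the reproducing kernel of $\Pi_n^2$ with respect to Lebesgue measure on $B^2$: $\mathbf{K}_n(\mathbf{x},\mathbf{y})=\sum_j p_j(\mathbf{x})p_j(\mathbf{y})$ for any orthonormal basis $(p_j)$ of $\Pi_n^2$ with respect to the inner product $\int_{B^2}fg\,d\mathbf{x}$. The Lebesgue constant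 is $\|\mathcal{L}_n\|=\sup\{\|\mathcal{L}_nf\|_{C(B^2)}: f\in C(B^2),\ \|f\|_{C(B^2)}\le 1\}$. *)

theory Defs
  imports "HOL-Analysis.Analysis"
begin

abbreviation disk :: "(real^2) set" where
  "disk \<equiv> cball 0 1"

text \<open>
  \<open>poly_space n\<close>: the polynomial functions of total degree at most \<open>n\<close>, as functions on the whole
  plane.  As the disk has nonempty interior, they are determined by their restriction to it.
\<close>

definition poly_space :: "nat \<Rightarrow> (real^2 \<Rightarrow> real) set" where
  "poly_space n = {f. \<exists>c. \<forall>x. f x = (\<Sum>i\<le>n. \<Sum>j\<le>n - i. c i j * (x $ 1) ^ i * (x $ 2) ^ j)}"

definition disk_inner :: "(real^2 \<Rightarrow> real) \<Rightarrow> (real^2 \<Rightarrow> real) \<Rightarrow> real" where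
  "disk_inner f g = (LINT x:disk|lborel. f x * g x)"

definition orthonormal_basis :: "nat \<Rightarrow> (real^2 \<Rightarrow> real) set \<Rightarrow> bool" where
  "orthonormal_basis n P \<longleftrightarrow>
     finite P \<and> P \<subseteq> poly_space n \<and>
     (\<forall>p\<in>P. \<forall>q\<in>P. disk_inner p q = (if p = q then 1 else 0)) \<and>
     (\<forall>f\<in>poly_space n. \<exists>a. \<forall>x. f x = (\<Sum>p\<in>P. a p * p x))"

definition repro_kernel :: "nat \<Rightarrow> real^2 \<Rightarrow> real^2 \<Rightarrow> real" where
  "repro_kernel n = (THE K. \<exists>P. orthonormal_basis n P \<and> K = (\<lambda>x y. \<Sum>p\<in>P. p x * p y))"

definition cubature :: "nat \<Rightarrow> 'i set \<Rightarrow> ('i \<Rightarrow> real) \<Rightarrow> ('i \<Rightarrow> real^2) \<Rightarrow> bool" where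
  "cubature N A w z \<longleftrightarrow>
     finite A \<and> (\<forall>\<alpha>\<in>A. w \<alpha> > 0 \<and> z \<alpha> \<in> disk) \<and>
     (\<forall>f\<in>poly_space N. (\<Sum>\<alpha>\<in>A. w \<alpha> * f (z \<alpha>)) = (LINT x:disk|lborel. f x))"

definition hyperinterp ::
  "nat \<Rightarrow> 'i set \<Rightarrow> ('i \<Rightarrow> real) \<Rightarrow> ('i \<Rightarrow> real^2) \<Rightarrow> (real^2 \<Rightarrow> real) \<Rightarrow> real^2 \<Rightarrow> real" where
  "hyperinterp n A w z f x = (\<Sum>\<alpha>\<in>A. w \<alpha> * repro_kernel n (z \<alpha>) x * f (z \<alpha>))"

text \<open>
  Elements of the space of continuous functions on the disk are represented by functions on the plane
  that are continuous on the disk; values outside it play no role.  The suprema below are taken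
  in the reals: they are over nonempty sets, and bounded whenever \<open>f\<close> is continuous on the disk and
  \<open>L\<close> is a hyperinterpolation operator, a finite sum of point evaluations times polynomials.
\<close>

definition disk_norm :: "(real^2 \<Rightarrow> real) \<Rightarrow> real" where
  "disk_norm f = (SUP x\<in>disk. \<bar>f x\<bar>)"

definition lebesgue_const :: "((real^2 \<Rightarrow> real) \<Rightarrow> real^2 \<Rightarrow> real) \<Rightarrow> real" where
  "lebesgue_const L = Sup {disk_norm (L f) | f. continuous_on disk f \<and> disk_norm f \<le> 1}"

lemma poly_space_sum:
  assumes "finite P" "P \<subseteq> poly_space n"
  shows "(\<lambda>x. \<Sum>p\<in>P. a p * p x) \<in> poly_space n"
proof -
  have "\<forall>p\<in>P. \<exists>c. \<forall>x. p x = (\<Sum>i\<le>n. \<Sum>j\<le>n - i. c i j * (x $ 1) ^ i * (x $ 2) ^ j)"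
    using assms(2) unfolding poly_space_def by blast
  from bchoice[OF this] obtain c where c: "\<And>p x. p \<in> P \<Longrightarrow>
      p x = (\<Sum>i\<le>n. \<Sum>j\<le>n - i. c p i j * (x $ 1) ^ i * (x $ 2) ^ j)"
    by blast
  have "(\<Sum>p\<in>P. a p * p x) =
      (\<Sum>i\<le>n. \<Sum>j\<le>n - i. (\<Sum>p\<in>P. a p * c p i j) * (x $ 1) ^ i * (x $ 2) ^ j)" for x
  proof -
    have "(\<Sum>p\<in>P. a p * p x) =
        (\<Sum>p\<in>P. \<Sum>i\<le>n. \<Sum>j\<le>n - i. a p * c p i j * (x $ 1) ^ i * (x $ 2) ^ j)"
    proof (intro sum.cong refl)
      fix p assume "p \<in> P"
      show "a p * p x = (\<Sum>i\<le>n. \<Sum>j\<le>n - i. a p * c p i j * (x $ 1) ^ i * (x $ 2) ^ j)"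
        by (subst c[OF \<open>p \<in> P\<close>]) (simp add: sum_distrib_left mult.assoc)
    qed
    also have "\<dots> = (\<Sum>i\<le>n. \<Sum>p\<in>P. \<Sum>j\<le>n - i. a p * c p i j * (x $ 1) ^ i * (x $ 2) ^ j)"
      by (rule sum.swap)
    also have "\<dots> = (\<Sum>i\<le>n. \<Sum>j\<le>n - i. \<Sum>p\<in>P. a p * c p i j * (x $ 1) ^ i * (x $ 2) ^ j)"
      by (intro sum.cong refl sum.swap)
    finally show ?thesis by (simp add: sum_distrib_right)
  qed
  then show ?thesis
    unfolding poly_space_def
    by (intro CollectI exI[of _ "\<lambda>i j. \<Sum>p\<in>P. a p * c p i j"] allI)
qed

lemma poly_space_lin:
  assumes "f \<in> poly_space n" "g \<in> poly_space n"
  shows "(\<lambda>x. a * f x + b * g x) \<in> poly_space n"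
proof -
  obtain c where c: "\<And>x. f x = (\<Sum>i\<le>n. \<Sum>j\<le>n - i. c i j * (x $ 1) ^ i * (x $ 2) ^ j)"
    using assms(1) unfolding poly_space_def by blast
  obtain d where d: "\<And>x. g x = (\<Sum>i\<le>n. \<Sum>j\<le>n - i. d i j * (x $ 1) ^ i * (x $ 2) ^ j)"
    using assms(2) unfolding poly_space_def by blast
  have "a * f x + b * g x =
      (\<Sum>i\<le>n. \<Sum>j\<le>n - i. (a * c i j + b * d i j) * (x $ 1) ^ i * (x $ 2) ^ j)" for x
    unfolding c d sum_distrib_left sum.distrib [symmetric]
    by (intro sum.cong refl) (simp add: algebra_simps)
  then show ?thesis
    unfolding poly_space_def
    by (intro CollectI exI[of _ "\<lambda>i j. a * c i j + b * d i j"] allI)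
qed

lemma poly_space_continuous: "f \<in> poly_space n \<Longrightarrow> continuous_on S f"
proof -
  assume "f \<in> poly_space n"
  then obtain c where "f = (\<lambda>x. \<Sum>i\<le>n. \<Sum>j\<le>n - i. c i j * (x $ 1) ^ i * (x $ 2) ^ j)"
    unfolding poly_space_def by blast
  then show ?thesis by (simp only:) (intro continuous_intros)
qed

lemma disk_inner_commute: "disk_inner f g = disk_inner g f"
  by (simp add: disk_inner_def mult.commute)

lemma set_integrable_disk:
  fixes f :: "real^2 \<Rightarrow> real"
  shows "continuous_on disk f \<Longrightarrow> set_integrable lborel disk f"
  unfolding set_integrable_def by (intro borel_integrable_compact) auto

lemma disk_inner_lin:
  assumes "continuous_on disk f" "continuous_on disk g" "continuous_on disk h"
  shows "disk_inner (\<lambda>x. a * f x + b * g x) h = a * disk_inner f h + b * disk_inner g h"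
proof -
  have "set_integrable lborel disk (\<lambda>x. a * (f x * h x))"
       "set_integrable lborel disk (\<lambda>x. b * (g x * h x))"
    using assms by (auto intro!: set_integrable_disk continuous_intros)
  from set_integral_add(2)[OF this] show ?thesis
    by (simp add: disk_inner_def algebra_simps)
qed

lemma disk_inner_sum:
  assumes "finite P" "\<And>p. p \<in> P \<Longrightarrow> continuous_on disk p" "continuous_on disk h"
  shows "disk_inner (\<lambda>x. \<Sum>p\<in>P. a p * p x) h = (\<Sum>p\<in>P. a p * disk_inner p h)"
  using assms
proof (induction P rule: finite_induct)
  case empty
  then show ?case by (simp add: disk_inner_def)
next
  case (insert q P)
  have "continuous_on disk (\<lambda>x. \<Sum>p\<in>P. a p * p x)"
    using insert by (intro continuous_intros) auto
  then have "disk_inner (\<lambda>x. a q * q x + 1 * (\<Sum>p\<in>P. a p * p x)) h =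
      a q * disk_inner q h + 1 * disk_inner (\<lambda>x. \<Sum>p\<in>P. a p * p x) h"
    using insert by (intro disk_inner_lin) auto
  then show ?case using insert by simp
qed

lemma disk_inner_nonneg: "disk_inner f f \<ge> 0"
  unfolding disk_inner_def set_lebesgue_integral_def by (rule integral_nonneg_AE) simp

lemma disk_inner_self_eq_0:
  assumes "f \<in> poly_space n" "disk_inner f f = 0"
  shows "f x = 0"
proof -
  have cont: "continuous_on S f" for S by (rule poly_space_continuous[OF assms(1)])
  have si: "set_integrable lborel disk (\<lambda>x. f x * f x)"
    by (intro set_integrable_disk continuous_intros cont)
  have I: "((\<lambda>x. f x * f x) has_integral 0) disk"
    using set_borel_integral_eq_integral[OF si] assms(2)
    unfolding disk_inner_def by (simp add: has_integral_integrable_integral)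
  have sq: "f y * f y = 0" if "y \<in> disk" for y
  proof (rule has_integral_0_closure_imp_0[where f = "\<lambda>y. f y * f y" and S = "ball 0 1"])
    show "continuous_on (closure (ball (0::real^2) 1)) (\<lambda>y. f y * f y)"
      by (intro continuous_on_mult cont)
    show "emeasure lborel (ball (0::real^2) 1) > 0"
      using emeasure_ball[of 1 "0::real^2"] unit_ball_vol_pos[of "real DIM(real^2)"] by simp
    show "emeasure lborel (ball (0::real^2) 1) < \<infinity>"
      using emeasure_lborel_ball_finite[of "0::real^2" 1] by simp
    show "emeasure lborel (closure (ball (0::real^2) 1)) = emeasure lborel (ball (0::real^2) 1)"
      using emeasure_ball[of 1 "0::real^2"] emeasure_cball[of 1 "0::real^2"] by simp
    show "((\<lambda>y. f y * f y) has_integral 0) (closure (ball 0 1))" using I by simp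
    show "y \<in> closure (ball 0 1)" using that by simp
  qed simp_all
  obtain c where c: "\<And>x. f x = (\<Sum>i\<le>n. \<Sum>j\<le>n - i. c i j * (x $ 1) ^ i * (x $ 2) ^ j)"
    using assms(1) unfolding poly_space_def by blast
  define q where "q = (\<Sum>i\<le>n. \<Sum>j\<le>n - i. Polynomial.monom (c i j * (x $ 1) ^ i * (x $ 2) ^ j) (i + j))"
  have q: "poly q t = f (t *\<^sub>R x)" for t
  proof -
    have "poly q t = (\<Sum>i\<le>n. \<Sum>j\<le>n - i. c i j * (x $ 1) ^ i * (x $ 2) ^ j * t ^ (i + j))"
      by (simp add: q_def poly_sum poly_monom)
    also have "\<dots> = (\<Sum>i\<le>n. \<Sum>j\<le>n - i. c i j * ((t *\<^sub>R x) $ 1) ^ i * ((t *\<^sub>R x) $ 2) ^ j)"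
    proof (intro sum.cong refl)
      fix i j
      show "c i j * (x $ 1) ^ i * (x $ 2) ^ j * t ^ (i + j) =
          c i j * ((t *\<^sub>R x) $ 1) ^ i * ((t *\<^sub>R x) $ 2) ^ j"
        by (simp add: power_mult_distrib power_add)
    qed
    also have "\<dots> = f (t *\<^sub>R x)" by (simp only: c)
    finally show ?thesis .
  qed
  have "poly q t = 0" if "0 < t" "t < 1 / (1 + norm x)" for t
  proof -
    have "t * norm x \<le> 1"
    proof -
      have "t * (1 + norm x) < 1" using that by (simp add: field_simps add_pos_nonneg)
      then show ?thesis using that by (simp add: algebra_simps)
    qed
    then show ?thesis using sq[of "t *\<^sub>R x"] that by (simp add: q)
  qed
  then have sub: "{0<..<1 / (1 + norm x)} \<subseteq> {t. poly q t = 0}" by auto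
  have "infinite {0<..<1 / (1 + norm x)}"
    by (rule infinite_Ioo) (simp add: add_pos_nonneg)
  then have "q = 0" using poly_roots_finite sub finite_subset by blast
  then show ?thesis using q[of 1] by simp
qed

lemma gram_schmidt:
  assumes "finite S" "S \<subseteq> poly_space n"
  shows "\<exists>P. finite P \<and> P \<subseteq> poly_space n \<and>
     (\<forall>p\<in>P. \<forall>q\<in>P. disk_inner p q = (if p = q then 1 else 0)) \<and>
     (\<forall>f\<in>S. \<exists>a. \<forall>x. f x = (\<Sum>p\<in>P. a p * p x))"
  using assms
proof (induction S rule: finite_induct)
  case empty
  then show ?case by (intro exI[of _ "{}"]) auto
next
  case (insert s S)
  then obtain P where P: "finite P" "P \<subseteq> poly_space n"
     "\<forall>p\<in>P. \<forall>q\<in>P. disk_inner p q = (if p = q then 1 else 0)"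
     "\<forall>f\<in>S. \<exists>a. \<forall>x. f x = (\<Sum>p\<in>P. a p * p x)" by blast
  define u where "u = (\<lambda>x. \<Sum>p\<in>P. disk_inner s p * p x)"
  define r where "r = (\<lambda>x. 1 * s x + (-1) * u x)"
  have s: "s \<in> poly_space n" using insert by auto
  have u: "u \<in> poly_space n" unfolding u_def by (rule poly_space_sum[OF P(1,2)])
  have r: "r \<in> poly_space n" unfolding r_def by (rule poly_space_lin[OF s u])
  have cP: "continuous_on disk p" if "p \<in> P" for p
    using that P(2) poly_space_continuous by blast
  note cs = poly_space_continuous[OF s] and cu = poly_space_continuous[OF u]
    and cr = poly_space_continuous[OF r]
  have orth: "disk_inner r q = 0" if "q \<in> P" for q
  proof -
    have "disk_inner u q = (\<Sum>p\<in>P. disk_inner s p * disk_inner p q)"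
      unfolding u_def by (rule disk_inner_sum) (use P cP that in auto)
    also have "\<dots> = (\<Sum>p\<in>P. if p = q then disk_inner s p else 0)"
      by (intro sum.cong refl) (use P(3) that in auto)
    also have "\<dots> = disk_inner s q" using that P(1) by simp
    finally show ?thesis
      unfolding r_def by (subst disk_inner_lin[OF cs cu cP[OF that]]) simp
  qed
  have s_eq: "s x = r x + u x" for x by (simp add: r_def)
  show ?case
  proof (cases "disk_inner r r = 0")
    case True
    then have "s x = (\<Sum>p\<in>P. disk_inner s p * p x)" for x
      using disk_inner_self_eq_0[OF r True] s_eq[of x] by (simp add: u_def)
    then have "\<exists>a. \<forall>x. s x = (\<Sum>p\<in>P. a p * p x)" by blast
    with P show ?thesis by (intro exI[of _ P]) blast
  next
    case False
    define k where "k = sqrt (disk_inner r r)"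
    have k: "k > 0" "k * k = disk_inner r r"
      using False disk_inner_nonneg[of r] by (auto simp: k_def)
    define e where "e = (\<lambda>x. (1 / k) * r x + 0 * r x)"
    have e: "e \<in> poly_space n" unfolding e_def by (rule poly_space_lin[OF r r])
    have ce: "continuous_on disk e" by (rule poly_space_continuous[OF e])
    have ip: "disk_inner e h = (1 / k) * disk_inner r h" if "continuous_on disk h" for h
      unfolding e_def by (subst disk_inner_lin[OF cr cr that]) simp
    have eP: "disk_inner e q = 0" "disk_inner q e = 0" if "q \<in> P" for q
      using ip[OF cP[OF that]] orth[OF that] disk_inner_commute[of q e] by auto
    have ee: "disk_inner e e = 1"
      using ip[OF ce] ip[OF cr] k False disk_inner_commute[of r e] by (simp add: field_simps)
    have "e \<notin> P" using eP ee by force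
    then have split: "(\<Sum>p\<in>insert e P. a p * p x) = a e * e x + (\<Sum>p\<in>P. a p * p x)" for a x
      using P(1) by simp
    have "\<exists>a. \<forall>x. f x = (\<Sum>p\<in>insert e P. a p * p x)" if "f \<in> insert s S" for f
    proof -
      have ex: "\<exists>a. \<forall>x. f x = (\<Sum>p\<in>insert e P. a p * p x)"
        if "\<And>x. f x = t * e x + (\<Sum>p\<in>P. a p * p x)" for t a
      proof (intro exI allI)
        fix x
        have "(\<Sum>p\<in>P. (a(e := t)) p * p x) = (\<Sum>p\<in>P. a p * p x)"
          by (intro sum.cong refl) (use \<open>e \<notin> P\<close> in auto)
        then show "f x = (\<Sum>p\<in>insert e P. (a(e := t)) p * p x)"
          using that[of x] split[of "a(e := t)" x] by simp
      qed
      show ?thesis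
      proof (cases "f = s")
        case True
        show ?thesis
        proof (rule ex[of k "disk_inner s"])
          fix x show "f x = k * e x + (\<Sum>p\<in>P. disk_inner s p * p x)"
            using True k(1) s_eq[of x] by (simp add: e_def u_def)
        qed
      next
        case False
        then obtain a where "\<And>x. f x = (\<Sum>p\<in>P. a p * p x)" using P(4) \<open>f \<in> insert s S\<close> by blast
        then show ?thesis using ex[of 0 a] by simp
      qed
    qed
    moreover have "\<forall>p\<in>insert e P. \<forall>q\<in>insert e P. disk_inner p q = (if p = q then 1 else 0)"
      using P(3) eP ee \<open>e \<notin> P\<close> by auto
    moreover have "finite (insert e P)" "insert e P \<subseteq> poly_space n"
      using P(1,2) e by auto
    ultimately show ?thesis by blast
  qed
qed

lemma orthonormal_basis_exists: "\<exists>P. orthonormal_basis n P"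
proof -
  define m :: "nat \<Rightarrow> nat \<Rightarrow> real^2 \<Rightarrow> real"
    where "m i j = (\<lambda>x. (x $ 1) ^ i * (x $ 2) ^ j)" for i j
  define S where "S = (\<lambda>(i, j). m i j) ` (SIGMA i:{..n}. {..n - i})"
  have mS: "m i j \<in> S" if "i \<le> n" "j \<le> n - i" for i j
    using that by (force simp: S_def)
  have "m i j \<in> poly_space n" if ij: "i \<le> n" "j \<le> n - i" for i j
  proof -
    have "(\<Sum>i'\<le>n. \<Sum>j'\<le>n - i'. (if i' = i then if j' = j then 1 else 0 else 0) * (x $ 1) ^ i' * (x $ 2) ^ j')
       = m i j x" for x
    proof -
      have "(\<Sum>i'\<le>n. \<Sum>j'\<le>n - i'. (if i' = i then if j' = j then 1 else 0 else 0) * (x $ 1) ^ i' * (x $ 2) ^ j')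
        = (\<Sum>i'\<le>n. if i' = i then (\<Sum>j'\<le>n - i. if j' = j then (x $ 1) ^ i * (x $ 2) ^ j else 0) else 0)"
      proof (intro sum.cong refl)
        fix i'
        have "(\<Sum>j'\<le>n - i. (if j' = j then 1 else 0) * (x $ 1) ^ i * (x $ 2) ^ j') =
            (\<Sum>j'\<le>n - i. if j' = j then (x $ 1) ^ i * (x $ 2) ^ j else 0)"
          by (intro sum.cong refl) simp
        then show "(\<Sum>j'\<le>n - i'. (if i' = i then if j' = j then 1 else 0 else 0) * (x $ 1) ^ i' * (x $ 2) ^ j')
            = (if i' = i then (\<Sum>j'\<le>n - i. if j' = j then (x $ 1) ^ i * (x $ 2) ^ j else 0) else 0)"
          by (cases "i' = i") simp_all
      qed
      also have "\<dots> = m i j x" using ij by (simp add: m_def)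
      finally show ?thesis .
    qed
    then show ?thesis unfolding poly_space_def
      by (intro CollectI exI[of _ "\<lambda>i' j'. if i' = i then if j' = j then 1 else 0 else 0"] allI)
        simp
  qed
  then have "S \<subseteq> poly_space n" by (auto simp: S_def)
  moreover have "finite S" by (auto simp: S_def)
  ultimately obtain P where P: "finite P" "P \<subseteq> poly_space n"
     "\<forall>p\<in>P. \<forall>q\<in>P. disk_inner p q = (if p = q then 1 else 0)"
     "\<forall>f\<in>S. \<exists>a. \<forall>x. f x = (\<Sum>p\<in>P. a p * p x)"
    using gram_schmidt[of S n] by blast
  from bchoice[OF P(4)] obtain a where a: "\<And>f x. f \<in> S \<Longrightarrow> f x = (\<Sum>p\<in>P. a f p * p x)"
    by blast
  have span: "\<exists>b. \<forall>x. f x = (\<Sum>p\<in>P. b p * p x)" if "f \<in> poly_space n" for f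
  proof -
    from that obtain c where c: "\<And>x. f x = (\<Sum>i\<le>n. \<Sum>j\<le>n - i. c i j * (x $ 1) ^ i * (x $ 2) ^ j)"
      unfolding poly_space_def by blast
    have eq: "f x = (\<Sum>p\<in>P. (\<Sum>i\<le>n. \<Sum>j\<le>n - i. c i j * a (m i j) p) * p x)" for x
    proof -
      have "f x = (\<Sum>i\<le>n. \<Sum>j\<le>n - i. c i j * m i j x)" by (simp add: c m_def mult.assoc)
      also have "\<dots> = (\<Sum>i\<le>n. \<Sum>j\<le>n - i. \<Sum>p\<in>P. c i j * a (m i j) p * p x)"
      proof (intro sum.cong refl)
        fix i j assume "i \<in> {..n}" "j \<in> {..n - i}"
        then show "c i j * m i j x = (\<Sum>p\<in>P. c i j * a (m i j) p * p x)"
          using a[OF mS[of i j], of x] by (simp add: sum_distrib_left mult.assoc)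
      qed
      also have "\<dots> = (\<Sum>i\<le>n. \<Sum>p\<in>P. \<Sum>j\<le>n - i. c i j * a (m i j) p * p x)"
        by (intro sum.cong refl sum.swap)
      also have "\<dots> = (\<Sum>p\<in>P. \<Sum>i\<le>n. \<Sum>j\<le>n - i. c i j * a (m i j) p * p x)"
        by (rule sum.swap)
      finally show ?thesis by (simp add: sum_distrib_right)
    qed
    show ?thesis
      by (rule exI[of _ "\<lambda>p. \<Sum>i\<le>n. \<Sum>j\<le>n - i. c i j * a (m i j) p"], rule allI, rule eq)
  qed
  have "\<forall>f\<in>poly_space n. \<exists>b. \<forall>x. f x = (\<Sum>p\<in>P. b p * p x)"
    by (rule ballI, rule span)
  with P(1-3) have "orthonormal_basis n P"
    unfolding orthonormal_basis_def by (intro conjI)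
  then show ?thesis ..
qed

lemma orthonormal_expansion:
  assumes "orthonormal_basis n P" "f \<in> poly_space n"
  shows "f x = (\<Sum>p\<in>P. disk_inner f p * p x)"
proof -
  have P: "finite P" "P \<subseteq> poly_space n"
     "\<And>p q. p \<in> P \<Longrightarrow> q \<in> P \<Longrightarrow> disk_inner p q = (if p = q then 1 else 0)"
    using assms(1) unfolding orthonormal_basis_def by blast+
  obtain a where a: "f = (\<lambda>x. \<Sum>p\<in>P. a p * p x)"
    using assms unfolding orthonormal_basis_def fun_eq_iff by blast
  have "disk_inner f q = a q" if "q \<in> P" for q
  proof -
    have "disk_inner f q = (\<Sum>p\<in>P. a p * disk_inner p q)"
      unfolding a using P that poly_space_continuous by (intro disk_inner_sum) blast+
    also have "\<dots> = (\<Sum>p\<in>P. if p = q then a p else 0)"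
      by (intro sum.cong refl) (use P(3) that in auto)
    finally show ?thesis using that P(1) by simp
  qed
  then show ?thesis by (simp add: a)
qed

text \<open>With \<open>orthonormal_basis_exists\<close>, this shows that the description in \<open>repro_kernel_def\<close> is proper.\<close>

lemma repro_kernel_eq:
  assumes P: "orthonormal_basis n P"
  shows "repro_kernel n = (\<lambda>x y. \<Sum>p\<in>P. p x * p y)"
proof -
  have eq: "(\<Sum>q\<in>Q. q x * q y) = (\<Sum>p\<in>P. p x * p y)" if Q: "orthonormal_basis n Q" for Q x y
  proof -
    have sub: "p \<in> poly_space n" if "p \<in> P \<or> p \<in> Q" for p
      using that P Q unfolding orthonormal_basis_def by blast
    have "(\<Sum>q\<in>Q. q x * q y) = (\<Sum>q\<in>Q. \<Sum>p\<in>P. q x * (disk_inner q p * p y))"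
    proof (intro sum.cong refl)
      fix q assume "q \<in> Q"
      then show "q x * q y = (\<Sum>p\<in>P. q x * (disk_inner q p * p y))"
        unfolding sum_distrib_left [symmetric]
        using orthonormal_expansion[OF P sub, of q y] by simp
    qed
    also have "\<dots> = (\<Sum>p\<in>P. \<Sum>q\<in>Q. q x * (disk_inner q p * p y))" by (rule sum.swap)
    also have "\<dots> = (\<Sum>p\<in>P. (\<Sum>q\<in>Q. disk_inner p q * q x) * p y)"
      by (simp only: sum_distrib_right)
        (intro sum.cong refl, subst disk_inner_commute, simp add: mult_ac)
    also have "\<dots> = (\<Sum>p\<in>P. p x * p y)"
    proof (intro sum.cong refl)
      fix p assume "p \<in> P"
      then show "(\<Sum>q\<in>Q. disk_inner p q * q x) * p y = p x * p y"
        using orthonormal_expansion[OF Q sub, of p x] by simp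
    qed
    finally show ?thesis .
  qed
  show ?thesis unfolding repro_kernel_def
  proof (rule the_equality)
    show "\<exists>Q. orthonormal_basis n Q \<and> (\<lambda>x y. \<Sum>p\<in>P. p x * p y) = (\<lambda>x y. \<Sum>p\<in>Q. p x * p y)"
      using P by blast
  next
    fix K :: "real^2 \<Rightarrow> real^2 \<Rightarrow> real"
    assume "\<exists>Q. orthonormal_basis n Q \<and> K = (\<lambda>x y. \<Sum>p\<in>Q. p x * p y)"
    then obtain Q where "orthonormal_basis n Q" "K = (\<lambda>x y. \<Sum>p\<in>Q. p x * p y)" by blast
    then show "K = (\<lambda>x y. \<Sum>p\<in>P. p x * p y)" using eq by (intro ext) simp
  qed
qed

end

theory Submission
  imports Defs
begin

text \<open>
  Let \<open>U\<^sub>k\<close> be the Chebyshev polynomials of the second kind and \<open>D\<^sub>n = \<Sum>k\<le>n. (k + 1) U\<^sub>k\<close>.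
  Lebesgue measure on the disk is the projection of the surface measure of the sphere \<open>S\<^sup>3\<close>,
  on which \<open>D\<^sub>n\<close> is the zonal reproducing kernel.  Hence \<open>\<pi> K\<^sub>n(x, y)\<close> is the average over \<open>\<phi>\<close> of
  \<open>D\<^sub>n (x \<bullet> y + sqrt (1 - \<bar>x\<bar>\<^sup>2) sqrt (1 - \<bar>y\<bar>\<^sup>2) cos \<phi>)\<close>.

  Upper bound: the identity \<open>U\<^sub>a U\<^sub>b - U\<^sub>a\<^sub>-\<^sub>1 U\<^sub>b\<^sub>-\<^sub>1 = U\<^sub>a\<^sub>+\<^sub>b\<close> writes \<open>D\<^sub>n\<close> as a sum of two convolutions of
  Chebyshev polynomials, so \<open>\<bar>D\<^sub>n\<bar> \<le> 2 \<Sum>k\<le>n. U\<^sub>k\<^sup>2\<close>.  The right-hand side has degree \<open>2n\<close>, so the cubature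
  formula integrates its average exactly, and each square contributes \<open>\<pi>\<close>.

  Lower bound: for a unit vector \<open>e\<close> the kernel is \<open>D\<^sub>n (x \<bullet> e) / \<pi>\<close>.  A single \<open>e\<close> does not suffice, since
  all nodes but \<open>e\<close> may lie on the zero lines of \<open>D\<^sub>n (x \<bullet> e)\<close>; but the mean over all \<open>e\<close> of
  \<open>\<bar>D\<^sub>n (x \<bullet> e)\<bar>\<close> is at least of order \<open>n\<close> whenever \<open>\<bar>x\<bar> \<ge> 1/2\<close>, and the nodes there carry a fixed part of
  the total weight.
\<close>

subsection \<open>Chebyshev polynomials of the second kind\<close>

fun cheb_U :: "nat \<Rightarrow> real poly" where
  "cheb_U 0 = 1"
| "cheb_U (Suc 0) = [:0, 2:]"
| "cheb_U (Suc (Suc n)) = [:0, 2:] * cheb_U (Suc n) - cheb_U n"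

lemma degree_cheb_U: "degree (cheb_U n) \<le> n"
proof (induction n rule: cheb_U.induct)
  case (3 n)
  have "degree ([:0, 2:] * cheb_U (Suc n)) \<le> Suc (Suc n)"
    using degree_mult_le[of "[:0, 2:]" "cheb_U (Suc n)"] 3 by simp
  then show ?case using 3 by (auto intro!: degree_diff_le)
qed auto

lemma sin_mult_cheb_U: "sin t * poly (cheb_U n) (cos t) = sin (real (Suc n) * t)"
proof (induction n rule: cheb_U.induct)
  case 2
  show ?case using sin_double[of t] by simp
next
  case (3 n)
  have "sin t * poly (cheb_U (Suc (Suc n))) (cos t) =
      2 * cos t * sin (real (Suc (Suc n)) * t) - sin (real (Suc n) * t)"
    using 3 by (simp add: algebra_simps)
  also have "\<dots> = sin (real (Suc (Suc (Suc n))) * t)"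
    using sin_add[of "real (Suc (Suc n)) * t" t] sin_diff[of "real (Suc (Suc n)) * t" t]
    by (simp add: algebra_simps)
  finally show ?case .
qed auto

text \<open>Both sides obey the three-term recurrence in \<open>a\<close>, so two base cases
  suffice. Indices are shifted by one so that no index -1 occurs.\<close>

lemma cheb_U_mult:
  "cheb_U (Suc a) * cheb_U (Suc b) = cheb_U (Suc (Suc (a + b))) + cheb_U a * cheb_U b"
proof (induction a rule: cheb_U.induct)
  case 1
  show ?case by (simp add: algebra_simps)
next
  case 2
  show ?case by (simp add: algebra_simps)
next
  case (3 n)
  have "cheb_U (Suc (Suc (Suc n))) * cheb_U (Suc b) =
      [:0, 2:] * (cheb_U (Suc (Suc n)) * cheb_U (Suc b)) - cheb_U (Suc n) * cheb_U (Suc b)"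
    by (simp add: algebra_simps del: mult_pCons_left mult_pCons_right)
  also have "\<dots> = [:0, 2:] * (cheb_U (Suc (Suc (Suc n + b))) + cheb_U (Suc n) * cheb_U b)
      - (cheb_U (Suc (Suc (n + b))) + cheb_U n * cheb_U b)"
    by (simp only: 3)
  also have "\<dots> = cheb_U (Suc (Suc (Suc (Suc n) + b))) + cheb_U (Suc (Suc n)) * cheb_U b"
    by (simp add: algebra_simps del: mult_pCons_left mult_pCons_right)
  finally show ?case .
qed

text \<open>Telescoping of \<open>cheb_U_mult\<close> along equal indices.\<close>

lemma cheb_U_square: "cheb_U n * cheb_U n = (\<Sum>j\<le>n. cheb_U (2 * j))"
proof (induction n)
  case (Suc n)
  show ?case by (simp only: cheb_U_mult sum.atMost_Suc Suc[symmetric]) (simp add: mult_2 add.commute)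
qed auto

section \<open>The kernel polynomial and its domination by squares of Chebyshev polynomials\<close>

definition dirichlet :: "nat \<Rightarrow> real poly" where
  "dirichlet n = (\<Sum>k\<le>n. of_nat (k + 1) * cheb_U k)"

text \<open>The coefficient of \<open>z ^ n\<close> in the square of the generating function of the
  \<open>cheb_U k\<close>.\<close>

definition cheb_conv :: "nat \<Rightarrow> real poly" where
  "cheb_conv n = (\<Sum>k\<le>n. cheb_U k * cheb_U (n - k))"

text \<open>The two end terms of the convolution give two copies of \<open>cheb_U (n + 2)\<close>.
  By \<open>cheb_U_mult\<close> each of the \<open>n + 1\<close> inner terms gives one more copy and
  a term of \<open>cheb_conv n\<close>.\<close>

lemma cheb_conv_Suc_Suc:
  "cheb_conv (Suc (Suc n)) = cheb_conv n + of_nat (n + 3) * cheb_U (n + 2)"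
proof -
  have "cheb_conv (Suc (Suc n)) =
      cheb_U (Suc (Suc n)) + (\<Sum>k\<le>n. cheb_U (Suc k) * cheb_U (Suc (n - k))) + cheb_U (Suc (Suc n))"
    unfolding cheb_conv_def sum.atMost_Suc_shift[of _ "Suc n"]
    by (simp add: sum.atMost_Suc Suc_diff_le del: cheb_U.simps(2,3))
  also have "(\<Sum>k\<le>n. cheb_U (Suc k) * cheb_U (Suc (n - k))) =
      (\<Sum>k\<le>n. cheb_U (Suc (Suc n)) + cheb_U k * cheb_U (n - k))"
    by (intro sum.cong refl) (simp add: cheb_U_mult del: cheb_U.simps(2,3))
  also have "\<dots> = of_nat (n + 1) * cheb_U (Suc (Suc n)) + cheb_conv n"
    by (simp add: sum.distrib cheb_conv_def del: cheb_U.simps(2,3))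
  finally show ?thesis by (simp add: algebra_simps del: cheb_U.simps(2,3))
qed

text \<open>By the recurrence, \<open>cheb_conv n\<close> collects the terms
  \<open>(k + 1) * cheb_U k\<close> for those \<open>k \<le> n\<close> that have the parity of
  \<open>n\<close>. Two consecutive convolutions therefore collect every term once.\<close>

lemma dirichlet_eq_conv: "dirichlet (Suc n) = cheb_conv (Suc n) + cheb_conv n"
proof (induction n)
  case 0
  show ?case by (simp add: dirichlet_def cheb_conv_def numeral_poly)
next
  case (Suc n)
  have "dirichlet (Suc (Suc n)) = dirichlet (Suc n) + of_nat (n + 3) * cheb_U (n + 2)"
    by (simp add: dirichlet_def algebra_simps del: cheb_U.simps(2,3))
  then show ?case using Suc cheb_conv_Suc_Suc[of n] by (simp add: algebra_simps)
qed

lemma abs_cheb_conv_le: "\<bar>poly (cheb_conv n) s\<bar> \<le> (\<Sum>k\<le>n. (poly (cheb_U k) s)\<^sup>2)"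
proof -
  have "\<bar>poly (cheb_conv n) s\<bar> \<le> (\<Sum>k\<le>n. \<bar>poly (cheb_U k) s * poly (cheb_U (n - k)) s\<bar>)"
    by (simp add: cheb_conv_def poly_sum)
  also have "\<dots> \<le> (\<Sum>k\<le>n. ((poly (cheb_U k) s)\<^sup>2 + (poly (cheb_U (n - k)) s)\<^sup>2) / 2)"
  proof (intro sum_mono)
    fix k
    have "0 \<le> (\<bar>poly (cheb_U k) s\<bar> - \<bar>poly (cheb_U (n - k)) s\<bar>)\<^sup>2" by simp
    then show "\<bar>poly (cheb_U k) s * poly (cheb_U (n - k)) s\<bar>
        \<le> ((poly (cheb_U k) s)\<^sup>2 + (poly (cheb_U (n - k)) s)\<^sup>2) / 2"
      by (simp add: power2_diff abs_mult)
  qed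
  also have "\<dots> = ((\<Sum>k\<le>n. (poly (cheb_U k) s)\<^sup>2) + (\<Sum>k\<le>n. (poly (cheb_U (n - k)) s)\<^sup>2)) / 2"
    by (simp add: sum_divide_distrib[symmetric] sum.distrib)
  also have "(\<Sum>k\<le>n. (poly (cheb_U (n - k)) s)\<^sup>2) = (\<Sum>k\<le>n. (poly (cheb_U k) s)\<^sup>2)"
    by (rule sum.reindex_bij_witness[of _ "\<lambda>k. n - k" "\<lambda>k. n - k"]) auto
  finally show ?thesis by simp
qed

lemma abs_dirichlet_le: "\<bar>poly (dirichlet n) s\<bar> \<le> 2 * (\<Sum>k\<le>n. (poly (cheb_U k) s)\<^sup>2)"
proof (cases n)
  case 0
  then show ?thesis by (simp add: dirichlet_def)
next
  case (Suc m)
  have "(\<Sum>k\<le>m. (poly (cheb_U k) s)\<^sup>2) \<le> (\<Sum>k\<le>n. (poly (cheb_U k) s)\<^sup>2)"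
    unfolding Suc by (simp del: cheb_U.simps)
  then show ?thesis
    using abs_cheb_conv_le[of n s] abs_cheb_conv_le[of m s] abs_triangle_ineq[of "poly (cheb_conv n) s" "poly (cheb_conv m) s"]
    unfolding Suc dirichlet_eq_conv poly_add by linarith
qed

text \<open>Multiplication by \<open>2 * (1 - cos t)\<close> acts on \<open>sin (m * t)\<close> as a
  negative second difference in \<open>m\<close>, so the weighted sine sum telescopes. The lower
  bound starts from this closed form.\<close>

lemma dirichlet_cos:
  "2 * (1 - cos t) * (sin t * poly (dirichlet n) (cos t)) =
     real (n + 2) * sin (real (n + 1) * t) - real (n + 1) * sin (real (n + 2) * t)"
proof (induction n)
  case 0
  show ?case using sin_double[of t] by (simp add: dirichlet_def algebra_simps)
next
  case (Suc n)
  have "sin t * poly (dirichlet (Suc n)) (cos t) =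
      sin t * poly (dirichlet n) (cos t) + real (n + 2) * (sin t * poly (cheb_U (Suc n)) (cos t))"
    by (simp add: dirichlet_def algebra_simps del: cheb_U.simps(2,3))
  then have "2 * (1 - cos t) * (sin t * poly (dirichlet (Suc n)) (cos t)) =
      real (n + 2) * sin (real (n + 1) * t) - real (n + 1) * sin (real (n + 2) * t)
      + 2 * (1 - cos t) * (real (n + 2) * sin (real (n + 2) * t))"
    using Suc unfolding sin_mult_cheb_U by (simp add: algebra_simps)
  moreover have "2 * cos t * sin (real (n + 2) * t) = sin (real (n + 3) * t) + sin (real (n + 1) * t)"
    using sin_add[of "real (n + 2) * t" t] sin_diff[of "real (n + 2) * t" t]
    by (simp add: algebra_simps)
  ultimately show ?case by (simp add: algebra_simps)
qed

lemma degree_dirichlet: "degree (dirichlet n) \<le> n"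
  unfolding dirichlet_def
proof (intro degree_sum_le)
  fix k assume k: "k \<in> {..n}"
  have "degree (of_nat (k + 1) * cheb_U k) \<le> degree (cheb_U k)"
    by (metis degree_of_nat degree_mult_le add_0)
  then show "degree (of_nat (k + 1) * cheb_U k) \<le> n" using degree_cheb_U[of k] k by simp
qed simp

lemma cheb_U_span:
  assumes "degree q \<le> n"
  shows "\<exists>c. q = (\<Sum>k\<le>n. smult (c k) (cheb_U k))"
  using assms
proof (induction n arbitrary: q)
  case 0
  then obtain a where "q = [:a:]" using degree_eq_zeroE by blast
  then show ?case by (intro exI[of _ "\<lambda>_. a"]) simp
next
  case (Suc n)
  have lead: "coeff (cheb_U m) m = 2 ^ m" for m
  proof (induction m rule: cheb_U.induct)
    case (3 m)
    have "coeff (cheb_U m) (Suc (Suc m)) = 0"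
      using degree_cheb_U[of m] by (intro coeff_eq_0) simp
    then show ?case using 3 by simp
  qed auto
  define r where "r = q - smult (coeff q (Suc n) / 2 ^ Suc n) (cheb_U (Suc n))"
  have "degree r \<le> Suc n"
    unfolding r_def using Suc(2) degree_cheb_U[of "Suc n"]
    by (intro degree_diff_le order.trans[OF degree_smult_le]) auto
  moreover have "coeff r (Suc n) = 0" by (simp add: r_def lead del: cheb_U.simps(2,3))
  ultimately have "degree r \<le> n"
    by (metis (no_types, lifting) coeff_eq_0 degree_le le_less_Suc_eq linorder_not_le not_less_eq)
  then obtain c where c: "r = (\<Sum>k\<le>n. smult (c k) (cheb_U k))" using Suc(1) by blast
  have "q = (\<Sum>k\<le>Suc n. smult ((c(Suc n := coeff q (Suc n) / 2 ^ Suc n)) k) (cheb_U k))"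
  proof -
    have "(\<Sum>k\<le>n. smult ((c(Suc n := coeff q (Suc n) / 2 ^ Suc n)) k) (cheb_U k)) = r"
      unfolding c by (intro sum.cong) auto
    then show ?thesis by (simp add: r_def del: cheb_U.simps(2,3))
  qed
  then show ?case by blast
qed

subsection \<open>Moments\<close>

definition cos_moment :: "nat \<Rightarrow> real" where
  "cos_moment i = integral {0..pi} (\<lambda>t. cos t ^ i) / pi"

lemma cos_moment_0: "cos_moment 0 = 1"
  by (simp add: cos_moment_def)

text \<open>Wallis' recurrence: integrate the derivative of \<open>sin t * cos t ^ (i + 1)\<close>,
  a function that vanishes at both ends.\<close>

lemma cos_moment_Suc_Suc: "real (i + 2) * cos_moment (i + 2) = real (i + 1) * cos_moment i"
proof -
  have int: "(\<lambda>t. cos t ^ k) integrable_on {0..pi}" for k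
    by (intro integrable_continuous_interval continuous_intros)
  have "((\<lambda>t. real (i + 2) * cos t ^ (i + 2) - real (i + 1) * cos t ^ i) has_integral
      sin pi * cos pi ^ (i + 1) - sin 0 * cos 0 ^ (i + 1)) {0..pi}"
  proof (rule fundamental_theorem_of_calculus)
    fix t :: real
    have "((\<lambda>t. sin t * cos t ^ (i + 1)) has_real_derivative
        cos t * cos t ^ (i + 1) + (real (i + 1) * cos t ^ i * (- sin t)) * sin t) (at t within {0..pi})"
      by (auto intro!: derivative_eq_intros simp del: power_Suc)
    moreover have "cos t * cos t ^ (i + 1) + (real (i + 1) * cos t ^ i * (- sin t)) * sin t =
        real (i + 2) * cos t ^ (i + 2) - real (i + 1) * cos t ^ i"
    proof -
      have "c * (P * c) + ((k + 1) * P * (- s)) * s = (k + 2) * (P * c * c) - (k + 1) * P"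
        if "s * s + c * c = 1" for s c P k :: real using that by algebra
      from this[of "sin t" "cos t" "cos t ^ i" "real i"] show ?thesis
        using sin_cos_squared_add[of t] by (simp add: power2_eq_square mult_ac add_ac)
    qed
    ultimately show "((\<lambda>t. sin t * cos t ^ (i + 1)) has_vector_derivative
        real (i + 2) * cos t ^ (i + 2) - real (i + 1) * cos t ^ i) (at t within {0..pi})"
      by (simp add: has_real_derivative_iff_has_vector_derivative)
  qed simp
  moreover have "((\<lambda>t. real (i + 2) * cos t ^ (i + 2) - real (i + 1) * cos t ^ i) has_integral
      real (i + 2) * integral {0..pi} (\<lambda>t. cos t ^ (i + 2)) - real (i + 1) * integral {0..pi} (\<lambda>t. cos t ^ i)) {0..pi}"
    by (intro has_integral_diff has_integral_mult_right integrable_integral int)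
  ultimately have "sin pi * cos pi ^ (i + 1) - sin 0 * cos 0 ^ (i + 1) =
      real (i + 2) * integral {0..pi} (\<lambda>t. cos t ^ (i + 2)) - real (i + 1) * integral {0..pi} (\<lambda>t. cos t ^ i)"
    by (rule has_integral_unique)
  then have "real (i + 2) * integral {0..pi} (\<lambda>t. cos t ^ (i + 2)) =
      real (i + 1) * integral {0..pi} (\<lambda>t. cos t ^ i)"
    by simp
  then show ?thesis by (simp add: cos_moment_def)
qed

lemma cos_moment_odd: "odd i \<Longrightarrow> cos_moment i = 0"
proof (induction i rule: nat_less_induct)
  case (1 i)
  consider "i = 1" | j where "i = j + 2"
    using 1(2) by (metis One_nat_def add_2_eq_Suc' even_zero not0_implies_Suc)
  then show ?case
  proof cases
    case 1
    have "(cos has_integral sin pi - sin 0) {0..pi}"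
      by (intro fundamental_theorem_of_calculus)
        (auto intro!: derivative_eq_intros simp flip: has_real_derivative_iff_has_vector_derivative)
    then show ?thesis using 1 by (simp add: cos_moment_def integral_unique)
  next
    case 2
    then show ?thesis using 1 cos_moment_Suc_Suc[of j] by simp
  qed
qed

definition beta_moment :: "nat \<Rightarrow> nat \<Rightarrow> real" where
  "beta_moment i j = integral {-1..1} (\<lambda>t. t ^ i * (1 - t\<^sup>2) ^ j)"

text \<open>Integration by parts: \<open>t ^ (i + 1) * (1 - t^2) ^ (j + 1)\<close> vanishes at -1
  and 1.\<close>

lemma beta_moment_rec:
  "real (i + 1) * beta_moment i (j + 1) = 2 * real (j + 1) * beta_moment (i + 2) j"
proof -
  have int: "(\<lambda>t::real. t ^ i * (1 - t\<^sup>2) ^ j) integrable_on {-1..1}" for i j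
    by (intro integrable_continuous_interval continuous_intros)
  have "((\<lambda>t::real. real (i + 1) * (t ^ i * (1 - t\<^sup>2) ^ (j + 1)) - 2 * real (j + 1) * (t ^ (i + 2) * (1 - t\<^sup>2) ^ j))
      has_integral 1 ^ (i + 1) * (1 - 1\<^sup>2) ^ (j + 1) - (- 1) ^ (i + 1) * (1 - (- 1)\<^sup>2) ^ (j + 1)) {-1..1}"
  proof (rule fundamental_theorem_of_calculus)
    fix t :: real
    have "((\<lambda>t. t ^ (i + 1) * (1 - t\<^sup>2) ^ (j + 1)) has_real_derivative
        real (i + 1) * t ^ i * (1 - t\<^sup>2) ^ (j + 1) + (real (j + 1) * (1 - t\<^sup>2) ^ j * (- (2 * t))) * t ^ (i + 1))
        (at t within {-1..1})"
      by (auto intro!: derivative_eq_intros simp del: power_Suc)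
    then show "((\<lambda>t. t ^ (i + 1) * (1 - t\<^sup>2) ^ (j + 1)) has_vector_derivative
        real (i + 1) * (t ^ i * (1 - t\<^sup>2) ^ (j + 1)) - 2 * real (j + 1) * (t ^ (i + 2) * (1 - t\<^sup>2) ^ j))
        (at t within {-1..1})"
      by (simp add: has_real_derivative_iff_has_vector_derivative algebra_simps)
  qed simp
  moreover have "((\<lambda>t::real. real (i + 1) * (t ^ i * (1 - t\<^sup>2) ^ (j + 1)) - 2 * real (j + 1) * (t ^ (i + 2) * (1 - t\<^sup>2) ^ j))
      has_integral real (i + 1) * beta_moment i (j + 1) - 2 * real (j + 1) * beta_moment (i + 2) j) {-1..1}"
    unfolding beta_moment_def
    by (intro has_integral_diff has_integral_mult_right integrable_integral int)
  ultimately have "1 ^ (i + 1) * (1 - 1\<^sup>2) ^ (j + 1) - (- 1) ^ (i + 1) * (1 - (- 1)\<^sup>2) ^ (j + 1) =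
      real (i + 1) * beta_moment i (j + 1) - 2 * real (j + 1) * beta_moment (i + 2) j"
    by (rule has_integral_unique)
  then show ?thesis by simp
qed

lemma beta_moment_0: "beta_moment i 0 = (1 - (- 1) ^ (i + 1)) / real (i + 1)"
proof -
  have "((\<lambda>t::real. t ^ i) has_integral 1 ^ (i + 1) / real (i + 1) - (- 1) ^ (i + 1) / real (i + 1)) {-1..1}"
    by (intro fundamental_theorem_of_calculus)
      (auto intro!: derivative_eq_intros simp del: power_Suc
        simp flip: has_real_derivative_iff_has_vector_derivative)
  then show ?thesis by (simp add: beta_moment_def integral_unique add_divide_distrib)
qed

lemma beta_moment_odd: "odd i \<Longrightarrow> beta_moment i j = 0"
proof (induction j arbitrary: i)
  case 0
  then show ?case by (simp add: beta_moment_0)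
next
  case (Suc j)
  then show ?case using beta_moment_rec[of i j] by simp
qed

text \<open>This identity turns the coefficients in the integral of \<open>mavg\<close> into
  binomial coefficients of \<open>i + j\<close>. The induction on \<open>j\<close> keeps
  \<open>i + j\<close> fixed, since the step applies the hypothesis at \<open>Suc i\<close>. The
  factors change by the ratios \<open>c1\<close>, \<open>c2\<close>, \<open>w\<close> and
  \<open>B\<close>.\<close>

lemma moment_product:
  "real ((2 * (i + j)) choose (2 * j)) * cos_moment (2 * j) * beta_moment (2 * i) j =
     real ((i + j) choose j) * (2 / (2 * real (i + j) + 1))"
proof (induction j arbitrary: i)
  case 0
  show ?case by (simp add: beta_moment_0 cos_moment_0)
next
  case (Suc j)
  define m where "m = i + Suc j"
  have b: "Suc k * (N choose Suc k) = (N - k) * (N choose k)" for k N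
    by (metis binomial_absorption binomial_absorb_comp)
  have c1: "real (2 * m choose (2 * Suc j)) * (real (2 * j + 1) * real (2 * j + 2)) =
      real (2 * m choose (2 * j)) * (real (2 * i + 1) * real (2 * i + 2))"
  proof -
    have "Suc (Suc (2 * j)) * (Suc (2 * j) * (2 * m choose Suc (Suc (2 * j)))) =
       Suc (2 * j) * ((2 * m - Suc (2 * j)) * (2 * m choose Suc (2 * j)))"
      using b[of "Suc (2 * j)" "2 * m"] by (metis mult.left_commute)
    also have "\<dots> = (2 * m - Suc (2 * j)) * ((2 * m - 2 * j) * (2 * m choose (2 * j)))"
      using b[of "2 * j" "2 * m"] by (metis mult.left_commute)
    also have "\<dots> = (2 * i + 1) * ((2 * i + 2) * (2 * m choose (2 * j)))"
      by (simp add: m_def)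
    finally have "Suc (Suc (2 * j)) * (Suc (2 * j) * (2 * m choose Suc (Suc (2 * j)))) =
        (2 * i + 1) * ((2 * i + 2) * (2 * m choose (2 * j)))" .
    then have "real (Suc (Suc (2 * j)) * (Suc (2 * j) * (2 * m choose Suc (Suc (2 * j))))) =
        real ((2 * i + 1) * ((2 * i + 2) * (2 * m choose (2 * j))))" by simp
    then show ?thesis by (simp add: algebra_simps)
  qed
  have c2: "real (m choose Suc j) * real (j + 1) = real (m choose j) * real (i + 1)"
  proof -
    have "Suc j * (m choose Suc j) = (i + 1) * (m choose j)"
      using b[of j m] by (simp add: m_def)
    then have "real (Suc j * (m choose Suc j)) = real ((i + 1) * (m choose j))" by simp
    then show ?thesis by (simp add: algebra_simps)
  qed
  have w: "real (2 * j + 2) * cos_moment (2 * Suc j) = real (2 * j + 1) * cos_moment (2 * j)"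
    using cos_moment_Suc_Suc[of "2 * j"] by simp
  have B: "real (2 * i + 1) * beta_moment (2 * i) (Suc j) = real (2 * j + 2) * beta_moment (2 * Suc i) j"
    using beta_moment_rec[of "2 * i" j] by simp
  have IH: "real (2 * m choose (2 * j)) * cos_moment (2 * j) * beta_moment (2 * Suc i) j =
     real (m choose j) * (2 / (2 * real m + 1))"
    using Suc[of "Suc i"] by (simp add: m_def)
  have two: "real (2 * i + 2) = 2 * real (i + 1)" and two': "real (2 * j + 2) = 2 * real (j + 1)" by auto
  \<comment> \<open>\<open>?K\<close> is the product of the left-hand factors in \<open>c1\<close>,
    \<open>w\<close> and \<open>B\<close>. It is nonzero and is cancelled at the end.\<close>
  let ?K = "real (2 * j + 1) * real (2 * j + 2) * real (2 * j + 2) * real (2 * i + 1)"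
  have "real (2 * m choose (2 * Suc j)) * cos_moment (2 * Suc j) * beta_moment (2 * i) (Suc j) * ?K =
     (real (2 * m choose (2 * Suc j)) * (real (2 * j + 1) * real (2 * j + 2))) *
     (real (2 * j + 2) * cos_moment (2 * Suc j)) * (real (2 * i + 1) * beta_moment (2 * i) (Suc j))"
    by (simp only: mult_ac)
  also have "\<dots> = (real (2 * m choose (2 * j)) * cos_moment (2 * j) * beta_moment (2 * Suc i) j) *
     (real (2 * i + 1) * real (2 * i + 2) * real (2 * j + 1) * real (2 * j + 2))"
    unfolding c1 w B by (simp only: mult_ac)
  also have "\<dots> = (real (m choose j) * real (i + 1)) * (2 / (2 * real m + 1)) * (2 * real (2 * i + 1) * real (2 * j + 1) * real (2 * j + 2))"
    unfolding IH by (simp only: two) (simp only: mult_ac)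
  also have "\<dots> = real (m choose Suc j) * (2 / (2 * real m + 1)) * ?K"
    unfolding c2[symmetric] by (simp only: two') (simp only: mult_ac)
  finally have "real (2 * m choose (2 * Suc j)) * cos_moment (2 * Suc j) * beta_moment (2 * i) (Suc j) =
      real (m choose Suc j) * (2 / (2 * real m + 1))"
    by (rule mult_right_cancel[THEN iffD1, rotated]) simp
  then show ?case by (simp only: m_def)
qed

subsection \<open>Averages over a circle\<close>

text \<open>The mean over a full circle: since the cosine is even, the half circle from 0 to
  \<open>pi\<close> gives the same value.\<close>

definition cavg :: "real poly \<Rightarrow> real \<Rightarrow> real \<Rightarrow> real" where
  "cavg p a b = integral {0..pi} (\<lambda>t. poly p (a + b * cos t)) / pi"

lemma cavg_integrable: "(\<lambda>t. poly p (a + b * cos t)) integrable_on {0..pi}"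
  by (intro integrable_continuous_interval continuous_intros)

lemma cavg_0 [simp]: "cavg p a 0 = poly p a"
  by (simp add: cavg_def)

lemma cavg_add: "cavg (p + q) a b = cavg p a b + cavg q a b"
  by (simp add: cavg_def integral_add cavg_integrable add_divide_distrib)

lemma cavg_smult: "cavg (smult c p) a b = c * cavg p a b"
  by (simp add: cavg_def)

lemma cavg_sum: "cavg (\<Sum>i\<in>I. p i) a b = (\<Sum>i\<in>I. cavg (p i) a b)"
proof (induction I rule: infinite_finite_induct)
  case (insert i I)
  then show ?case by (simp add: cavg_add)
qed (simp_all add: cavg_def)

lemma abs_cavg_le:
  assumes "\<And>s. \<bar>poly p s\<bar> \<le> poly q s"
  shows "\<bar>cavg p a b\<bar> \<le> cavg q a b"
proof -
  have "norm (integral {0..pi} (\<lambda>t. poly p (a + b * cos t))) \<le> integral {0..pi} (\<lambda>t. poly q (a + b * cos t))"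
    using assms by (intro integral_norm_bound_integral cavg_integrable) auto
  then show ?thesis by (simp add: cavg_def divide_right_mono)
qed

lemma cavg_pcompose: "cavg p (u + r * a) (r * b) = cavg (pcompose p [:u, r:]) a b"
  by (simp add: cavg_def poly_pcompose algebra_simps)

text \<open>
  The average of the \<open>m\<close>-th power with \<open>c = b\<^sup>2\<close>: the odd powers of \<open>b\<close> vanish, so that for
  \<open>b = sqrt ((1 - \<bar>x\<bar>\<^sup>2) (1 - \<bar>y\<bar>\<^sup>2))\<close> the average is a polynomial in \<open>y\<close>.
\<close>

definition mavg :: "nat \<Rightarrow> real \<Rightarrow> real \<Rightarrow> real" where
  "mavg m a c = (\<Sum>j\<le>m div 2. real (m choose (2 * j)) * cos_moment (2 * j) * (a ^ (m - 2 * j) * c ^ j))"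

lemma sum_even_terms:
  fixes f :: "nat \<Rightarrow> 'a::comm_monoid_add"
  assumes "\<And>i. odd i \<Longrightarrow> f i = 0"
  shows "(\<Sum>i\<le>m. f i) = (\<Sum>j\<le>m div 2. f (2 * j))"
proof -
  have "(\<Sum>i\<le>m. f i) = (\<Sum>i\<in>{i. i \<le> m \<and> even i}. f i)"
    using assms by (intro sum.mono_neutral_right) auto
  also have "\<dots> = (\<Sum>j\<le>m div 2. f (2 * j))"
    by (rule sum.reindex_bij_witness[of _ "\<lambda>j. 2 * j" "\<lambda>i. i div 2"]) auto
  finally show ?thesis .
qed

lemma cavg_monom: "cavg (monom 1 m) a b = mavg m a (b\<^sup>2)"
proof -
  have "integral {0..pi} (\<lambda>t. poly (monom 1 m) (a + b * cos t)) =
      integral {0..pi} (\<lambda>t. \<Sum>i\<le>m. (real (m choose i) * b ^ i * a ^ (m - i)) * cos t ^ i)"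
    by (intro integral_cong, subst add.commute)
      (simp add: poly_monom binomial_ring power_mult_distrib mult_ac)
  also have "\<dots> = (\<Sum>i\<le>m. integral {0..pi} (\<lambda>t. (real (m choose i) * b ^ i * a ^ (m - i)) * cos t ^ i))"
    by (intro integral_sum integrable_continuous_interval continuous_intros) auto
  also have "\<dots> = (\<Sum>i\<le>m. real (m choose i) * b ^ i * a ^ (m - i) * (pi * cos_moment i))"
    by (simp add: cos_moment_def)
  also have "\<dots> = pi * (\<Sum>i\<le>m. real (m choose i) * cos_moment i * (a ^ (m - i) * b ^ i))"
    by (simp add: sum_distrib_left mult_ac)
  also have "(\<Sum>i\<le>m. real (m choose i) * cos_moment i * (a ^ (m - i) * b ^ i)) = mavg m a (b\<^sup>2)"
    unfolding mavg_def by (subst sum_even_terms) (simp_all add: cos_moment_odd power_mult)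
  finally show ?thesis by (simp add: cavg_def)
qed

lemma cavg_eq_mavg: "cavg p a b = (\<Sum>m\<le>degree p. coeff p m * mavg m a (b\<^sup>2))"
proof -
  have "p = (\<Sum>m\<le>degree p. smult (coeff p m) (monom 1 m))"
    by (simp add: smult_monom poly_as_sum_of_monoms)
  then have "cavg p a b = cavg (\<Sum>m\<le>degree p. smult (coeff p m) (monom 1 m)) a b" by simp
  then show ?thesis by (simp only: cavg_sum cavg_smult cavg_monom)
qed

text \<open>Archimedes' theorem for the \<open>m\<close>-th power. For even \<open>m\<close>,
  \<open>moment_product\<close> makes the sum a binomial expansion of
  \<open>(a^2 + b^2) ^ (m div 2)\<close>; for odd \<open>m\<close> every summand is odd in
  \<open>t\<close>.\<close>

lemma mavg_integral:
  "((\<lambda>t. mavg m (a * t) (b\<^sup>2 * (1 - t\<^sup>2))) has_integral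
     (if even m then (a\<^sup>2 + b\<^sup>2) ^ (m div 2) * (2 / (real m + 1)) else 0)) {-1..1}"
proof -
  have "((\<lambda>t::real. \<Sum>j\<le>m div 2. real (m choose (2 * j)) * cos_moment (2 * j) * (a ^ (m - 2 * j) * b ^ (2 * j)) *
      (t ^ (m - 2 * j) * (1 - t\<^sup>2) ^ j)) has_integral
      (\<Sum>j\<le>m div 2. real (m choose (2 * j)) * cos_moment (2 * j) * (a ^ (m - 2 * j) * b ^ (2 * j)) *
        beta_moment (m - 2 * j) j)) {-1..1}"
    unfolding beta_moment_def
    by (intro has_integral_sum has_integral_mult_right integrable_integral
        integrable_continuous_interval continuous_intros) auto
  also have "(\<lambda>t::real. \<Sum>j\<le>m div 2. real (m choose (2 * j)) * cos_moment (2 * j) * (a ^ (m - 2 * j) * b ^ (2 * j)) *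
      (t ^ (m - 2 * j) * (1 - t\<^sup>2) ^ j)) = (\<lambda>t. mavg m (a * t) (b\<^sup>2 * (1 - t\<^sup>2)))"
    unfolding mavg_def power_mult_distrib power_mult by (simp only: mult_ac)
  also have "(\<Sum>j\<le>m div 2. real (m choose (2 * j)) * cos_moment (2 * j) * (a ^ (m - 2 * j) * b ^ (2 * j)) *
        beta_moment (m - 2 * j) j) = (if even m then (a\<^sup>2 + b\<^sup>2) ^ (m div 2) * (2 / (real m + 1)) else 0)"
  proof (cases "even m")
    case False
    then have "beta_moment (m - 2 * j) j = 0" if "j \<le> m div 2" for j
      using that by (intro beta_moment_odd) auto
    then show ?thesis using False by simp
  next
    case True
    then obtain k where k: "m = 2 * k" by blast
    have "(\<Sum>j\<le>m div 2. real (m choose (2 * j)) * cos_moment (2 * j) * (a ^ (m - 2 * j) * b ^ (2 * j)) *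
        beta_moment (m - 2 * j) j) =
      (\<Sum>j\<le>k. (2 / (real m + 1)) * (real (k choose j) * (b\<^sup>2) ^ j * (a\<^sup>2) ^ (k - j)))"
    proof (rule sum.cong)
      fix j assume j: "j \<in> {..k}"
      have e: "real (m choose (2 * j)) * cos_moment (2 * j) * beta_moment (m - 2 * j) j =
          real (k choose j) * (2 / (real m + 1))"
        using moment_product[of "k - j" j] j by (simp add: k diff_mult_distrib2)
      have "real (m choose (2 * j)) * cos_moment (2 * j) * (a ^ (m - 2 * j) * b ^ (2 * j)) * beta_moment (m - 2 * j) j
        = (real (m choose (2 * j)) * cos_moment (2 * j) * beta_moment (m - 2 * j) j) * (a ^ (m - 2 * j) * b ^ (2 * j))"
        by (simp only: mult_ac)
      also have "\<dots> = (2 / (real m + 1)) * (real (k choose j) * b ^ (2 * j) * a ^ (2 * (k - j)))"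
        unfolding e by (simp add: k diff_mult_distrib2)
      finally show "real (m choose (2 * j)) * cos_moment (2 * j) * (a ^ (m - 2 * j) * b ^ (2 * j)) * beta_moment (m - 2 * j) j
        = (2 / (real m + 1)) * (real (k choose j) * (b\<^sup>2) ^ j * (a\<^sup>2) ^ (k - j))"
        by (simp only: power_mult)
    qed (simp add: k)
    also have "\<dots> = (b\<^sup>2 + a\<^sup>2) ^ k * (2 / (real m + 1))"
      unfolding sum_distrib_left[symmetric] by (simp add: binomial_ring)
    finally show ?thesis using True by (simp add: k add.commute)
  qed
  finally show ?thesis .
qed

text \<open>
  Archimedes' theorem: \<open>t\<close> and the angle inside \<^const>\<open>cavg\<close> are cylindrical coordinates on the unit
  sphere, where a linear form of norm \<open>r\<close> is uniformly distributed in \<open>[-r, r]\<close>.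
\<close>

lemma cavg_sphere:
  "((\<lambda>t. cavg p (a * t) (b * sqrt (1 - t\<^sup>2))) has_integral
      integral {-1..1} (\<lambda>t. poly p (sqrt (a\<^sup>2 + b\<^sup>2) * t))) {-1..1}"
proof -
  let ?r = "sqrt (a\<^sup>2 + b\<^sup>2)"
  \<comment> \<open>The case \<open>b = 0\<close> of \<open>mavg_integral\<close> with
    \<open>a = ?r\<close>: both integrals agree on every power, hence on every polynomial.\<close>
  have M: "((\<lambda>t. (?r * t) ^ m) has_integral
     (if even m then (a\<^sup>2 + b\<^sup>2) ^ (m div 2) * (2 / (real m + 1)) else 0)) {-1..1}" for m
  proof -
    have "mavg m x 0 = x ^ m" for x
      by (simp add: mavg_def power_0_left cos_moment_0 if_distrib sum.delta cong: if_cong)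
    moreover have r: "?r\<^sup>2 + 0\<^sup>2 = a\<^sup>2 + b\<^sup>2" by simp
    ultimately show ?thesis using mavg_integral[of m ?r 0] unfolding r by simp
  qed
  have "((\<lambda>t. \<Sum>m\<le>degree p. coeff p m * (?r * t) ^ m) has_integral
      (\<Sum>m\<le>degree p. coeff p m * (if even m then (a\<^sup>2 + b\<^sup>2) ^ (m div 2) * (2 / (real m + 1)) else 0))) {-1..1}"
    by (intro has_integral_sum has_integral_mult_right M) auto
  then have R: "integral {-1..1} (\<lambda>t. poly p (?r * t)) =
      (\<Sum>m\<le>degree p. coeff p m * (if even m then (a\<^sup>2 + b\<^sup>2) ^ (m div 2) * (2 / (real m + 1)) else 0))"
    unfolding poly_altdef by (rule integral_unique)
  have "((\<lambda>t. \<Sum>m\<le>degree p. coeff p m * mavg m (a * t) (b\<^sup>2 * (1 - t\<^sup>2))) has_integral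
      integral {-1..1} (\<lambda>t. poly p (?r * t))) {-1..1}"
    unfolding R by (intro has_integral_sum has_integral_mult_right mavg_integral) auto
  then show ?thesis
  proof (rule has_integral_eq[rotated])
    fix t :: real assume "t \<in> {-1..1}"
    then have "t\<^sup>2 \<le> 1" by (simp add: abs_square_le_1 abs_le_iff)
    then show "(\<Sum>m\<le>degree p. coeff p m * mavg m (a * t) (b\<^sup>2 * (1 - t\<^sup>2))) = cavg p (a * t) (b * sqrt (1 - t\<^sup>2))"
      by (simp add: cavg_eq_mavg power_mult_distrib)
  qed
qed

section \<open>Product formula and orthogonality of the Chebyshev polynomials\<close>

lemma cheb_U_at_1: "poly (cheb_U k) 1 = real (k + 1)"
  by (induction k rule: cheb_U.induct) auto

lemma cheb_U_minus: "poly (cheb_U k) (- s) = (- 1) ^ k * poly (cheb_U k) s"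
  by (induction k rule: cheb_U.induct) (auto simp: algebra_simps)

text \<open>Gegenbauer's product formula. With \<open>a = cos \<alpha>\<close> and
  \<open>s = cos \<beta>\<close> the argument runs from \<open>cos (\<alpha> + \<beta>)\<close> to
  \<open>cos (\<alpha> - \<beta>)\<close>. Substituting a cosine turns the integrand into
  \<open>sin ((k + 1) * x)\<close>, and the difference of cosines that results is twice a product of
  sines.\<close>

lemma cheb_U_product_formula:
  assumes "\<bar>a\<bar> \<le> 1" "\<bar>s\<bar> \<le> 1"
  shows "integral {-1..1} (\<lambda>t. poly (cheb_U k) (a * s + sqrt (1 - a\<^sup>2) * sqrt (1 - s\<^sup>2) * t)) =
     2 * (poly (cheb_U k) a * poly (cheb_U k) s) / real (k + 1)"
proof -
  \<comment> \<open>If \<open>a\<close> or \<open>s\<close> is -1 or 1, the range of the argument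
    shrinks to a point and the substitution would divide by zero; the values at -1 and 1 settle this
    case.\<close>
  have edge: "poly (cheb_U k) (a * s) * real (k + 1) = poly (cheb_U k) a * poly (cheb_U k) s" if "a\<^sup>2 = 1" for a s
  proof -
    have "a = 1 \<or> a = -1" using that by (simp add: power2_eq_1_iff)
    then show ?thesis using cheb_U_minus[of k s] cheb_U_minus[of k 1] by (auto simp: cheb_U_at_1)
  qed
  show ?thesis
  proof (cases "a\<^sup>2 = 1 \<or> s\<^sup>2 = 1")
    case True
    then have "sqrt (1 - a\<^sup>2) * sqrt (1 - s\<^sup>2) = 0" by auto
    then have "integral {-1..1} (\<lambda>t. poly (cheb_U k) (a * s + sqrt (1 - a\<^sup>2) * sqrt (1 - s\<^sup>2) * t)) =
        2 * poly (cheb_U k) (a * s)"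
      by (simp only:) simp
    moreover have "poly (cheb_U k) (a * s) * real (k + 1) = poly (cheb_U k) a * poly (cheb_U k) s"
      using True edge[of a s] edge[of s a] by (auto simp: mult.commute)
    ultimately show ?thesis by (simp add: field_simps)
  next
    case False
    define \<alpha> where "\<alpha> = arccos a"
    define \<beta> where "\<beta> = arccos s"
    have a: "cos \<alpha> = a" "0 \<le> \<alpha>" "\<alpha> \<le> pi" "sin \<alpha> = sqrt (1 - a\<^sup>2)"
      using assms by (auto simp: \<alpha>_def arccos_lbound arccos_ubound cos_arccos sin_arccos abs_le_iff)
    have b: "cos \<beta> = s" "0 \<le> \<beta>" "\<beta> \<le> pi" "sin \<beta> = sqrt (1 - s\<^sup>2)"
      using assms by (auto simp: \<beta>_def arccos_lbound arccos_ubound cos_arccos sin_arccos abs_le_iff)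
    have lt: "a\<^sup>2 < 1" "s\<^sup>2 < 1" using False assms by (auto simp: abs_square_le_1 order_less_le)
    define m where "m = sin \<alpha> * sin \<beta>"
    have m: "m > 0" using lt by (simp add: m_def a b)
    let ?U = "\<lambda>x. poly (cheb_U k) x"
    \<comment> \<open>The general rule allows ranges on which the cosine is not monotone, as happens
      when 0 lies inside. It subtracts the two orientations, and the first interval turns out to be
      empty.\<close>
    have "((\<lambda>x. - sin x *\<^sub>R ?U (cos x)) has_integral
        (integral {cos (\<alpha> - \<beta>)..cos (\<alpha> + \<beta>)} ?U - integral {cos (\<alpha> + \<beta>)..cos (\<alpha> - \<beta>)} ?U)) {\<alpha> - \<beta>..\<alpha> + \<beta>}"
      by (rule has_integral_substitution_general[of "{}" _ _ _ "-1" 1])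
        (use b in \<open>auto intro!: continuous_intros derivative_eq_intros\<close>)
    moreover have "cos (\<alpha> + \<beta>) < cos (\<alpha> - \<beta>)"
      using m by (simp add: m_def cos_add cos_diff)
    moreover have "- sin x *\<^sub>R ?U (cos x) = - sin (real (k + 1) * x)" for x
      using sin_mult_cheb_U[of x k] by simp
    ultimately have 1: "((\<lambda>x. - sin (real (k + 1) * x)) has_integral
        - integral {cos (\<alpha> + \<beta>)..cos (\<alpha> - \<beta>)} ?U) {\<alpha> - \<beta>..\<alpha> + \<beta>}" by simp
    have "((\<lambda>x. - sin (real (k + 1) * x)) has_integral
        cos (real (k + 1) * (\<alpha> + \<beta>)) / real (k + 1) - cos (real (k + 1) * (\<alpha> - \<beta>)) / real (k + 1)) {\<alpha> - \<beta>..\<alpha> + \<beta>}"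
      by (intro fundamental_theorem_of_calculus)
        (use b in \<open>auto intro!: derivative_eq_intros simp flip: has_real_derivative_iff_has_vector_derivative\<close>)
    from has_integral_unique[OF 1 this]
    have "integral {cos (\<alpha> + \<beta>)..cos (\<alpha> - \<beta>)} ?U =
        (cos (real (k + 1) * (\<alpha> - \<beta>)) - cos (real (k + 1) * (\<alpha> + \<beta>))) / real (k + 1)"
      by (simp add: diff_divide_distrib)
    also have "cos (real (k + 1) * (\<alpha> - \<beta>)) - cos (real (k + 1) * (\<alpha> + \<beta>)) =
        2 * (sin (real (Suc k) * \<alpha>) * sin (real (Suc k) * \<beta>))"
      by (simp add: right_diff_distrib distrib_left cos_add cos_diff del: of_nat_Suc)
    also have "\<dots> = 2 * m * (?U a * ?U s)"
      unfolding sin_mult_cheb_U[symmetric] m_def a b by simp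
    finally have 2: "integral {cos (\<alpha> + \<beta>)..cos (\<alpha> - \<beta>)} ?U = m * (2 * (?U a * ?U s) / real (k + 1))"
      by simp
    have mt: "- m \<le> m * t \<and> m * t \<le> m" if "- 1 \<le> t" "t \<le> 1" for t
      using that m mult_left_mono[of "- 1" t m] mult_left_mono[of t 1 m] by simp
    have "((\<lambda>t. m *\<^sub>R ?U (a * s + m * t)) has_integral
        (integral {a * s + m * (-1)..a * s + m * 1} ?U)) {-1..1}"
      by (rule has_integral_substitution[of _ _ _ "a * s - m" "a * s + m"])
        (use m mt in \<open>auto intro!: continuous_intros derivative_eq_intros\<close>)
    then have "integral {-1..1} (\<lambda>t. m *\<^sub>R ?U (a * s + m * t)) = integral {a * s + m * (-1)..a * s + m * 1} ?U"
      by (rule integral_unique)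
    then have "m * integral {-1..1} (\<lambda>t. ?U (a * s + m * t)) = integral {cos (\<alpha> + \<beta>)..cos (\<alpha> - \<beta>)} ?U"
      by (simp add: cos_add cos_diff m_def a b)
    then have "integral {-1..1} (\<lambda>t. ?U (a * s + m * t)) = 2 * (?U a * ?U s) / real (k + 1)"
      unfolding 2 using m by (simp only: mult_cancel_left) auto
    then show ?thesis by (simp only: m_def a b)
  qed
qed

lemma integral_semicircle:
  "((\<lambda>s. poly p s * sqrt (1 - s\<^sup>2)) has_integral integral {0..pi} (\<lambda>t. poly p (cos t) * (sin t)\<^sup>2)) {-1..1}"
proof -
  let ?f = "\<lambda>s. poly p s * sqrt (1 - s\<^sup>2)"
  have c: "continuous_on {-1..1} ?f" by (intro continuous_intros)
  have "((\<lambda>x. - sin x *\<^sub>R ?f (cos x)) has_integral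
      (integral {cos 0..cos pi} ?f - integral {cos pi..cos 0} ?f)) {0..pi}"
    by (rule has_integral_substitution_general[of "{}" _ _ _ "-1" 1])
      (use c in \<open>auto intro!: continuous_intros derivative_eq_intros\<close>)
  then have "((\<lambda>x. - sin x *\<^sub>R ?f (cos x)) has_integral - integral {-1..1} ?f) {0..pi}" by simp
  then have "((\<lambda>x. - (- sin x *\<^sub>R ?f (cos x))) has_integral integral {-1..1} ?f) {0..pi}"
    unfolding has_integral_neg_iff by simp
  then have "((\<lambda>x. poly p (cos x) * (sin x)\<^sup>2) has_integral integral {-1..1} ?f) {0..pi}"
  proof (rule has_integral_eq[rotated])
    fix x assume "x \<in> {0..pi}"
    then have "sqrt (1 - (cos x)\<^sup>2) = sin x"
      by (metis atLeastAtMost_iff sin_ge_zero sin_squared_eq real_sqrt_abs abs_of_nonneg)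
    then show "- (- sin x *\<^sub>R ?f (cos x)) = poly p (cos x) * (sin x)\<^sup>2"
      by (simp add: power2_eq_square)
  qed
  then have "integral {0..pi} (\<lambda>t. poly p (cos t) * (sin t)\<^sup>2) = integral {-1..1} ?f"
    by (rule integral_unique)
  then show ?thesis
    using integrable_integral[OF integrable_continuous_interval[OF c]] by simp
qed

lemma cheb_U_orthogonal:
  "integral {-1..1} (\<lambda>s. poly (cheb_U k) s * poly (cheb_U m) s * sqrt (1 - s\<^sup>2)) =
     (if k = m then pi / 2 else 0)"
proof -
  \<comment> \<open>Integer frequencies accommodate the difference of \<open>k\<close> and
    \<open>m\<close>; frequency zero produces the diagonal value.\<close>
  have C: "((\<lambda>t. cos (of_int c * t)) has_integral (if c = 0 then pi else 0)) {0..pi}" for c :: int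
  proof (cases "c = 0")
    case True
    then show ?thesis using has_integral_const_real[of "1::real" 0 pi] by simp
  next
    case False
    have "((\<lambda>t. cos (of_int c * t)) has_integral sin (of_int c * pi) / of_int c - sin (of_int c * 0) / of_int c) {0..pi}"
      by (intro fundamental_theorem_of_calculus)
        (use False in \<open>auto intro!: derivative_eq_intros simp flip: has_real_derivative_iff_has_vector_derivative\<close>)
    then show ?thesis using False by (simp add: mult.commute)
  qed
  have "integral {-1..1} (\<lambda>s. poly (cheb_U k * cheb_U m) s * sqrt (1 - s\<^sup>2)) =
      integral {0..pi} (\<lambda>t. poly (cheb_U k * cheb_U m) (cos t) * (sin t)\<^sup>2)"
    by (rule integral_unique[OF integral_semicircle])
  also have "\<dots> = integral {0..pi} (\<lambda>t. (1 / 2) * (cos (of_int (int k - int m) * t) - cos (of_int (int k + int m + 2) * t)))"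
  proof (rule integral_cong)
    fix t :: real
    have "poly (cheb_U k * cheb_U m) (cos t) * (sin t)\<^sup>2 = sin (real (Suc k) * t) * sin (real (Suc m) * t)"
      unfolding sin_mult_cheb_U[symmetric] by (simp add: power2_eq_square)
    also have "\<dots> = (1 / 2) * (cos (real (Suc k) * t - real (Suc m) * t) - cos (real (Suc k) * t + real (Suc m) * t))"
      by (simp add: cos_add cos_diff)
    also have "real (Suc k) * t - real (Suc m) * t = of_int (int k - int m) * t"
      by (simp add: algebra_simps)
    also have "real (Suc k) * t + real (Suc m) * t = of_int (int k + int m + 2) * t"
      by (simp add: algebra_simps)
    finally show "poly (cheb_U k * cheb_U m) (cos t) * (sin t)\<^sup>2 =
      (1 / 2) * (cos (of_int (int k - int m) * t) - cos (of_int (int k + int m + 2) * t))" .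
  qed
  also have "\<dots> = (1 / 2) * ((if int k - int m = 0 then pi else 0) - (if int k + int m + 2 = 0 then pi else 0))"
    by (intro integral_unique has_integral_mult_right has_integral_diff C)
  also have "\<dots> = (if k = m then pi / 2 else 0)" by auto
  finally show ?thesis by simp
qed

subsection \<open>Integration over the disk\<close>

lemma norm_real2: "norm (x :: real^2) = sqrt ((x $ 1)\<^sup>2 + (x $ 2)\<^sup>2)"
  by (simp add: norm_eq_sqrt_inner inner_vec_def sum_2 power2_eq_square)

lemma mem_disk_iff: "x \<in> disk \<longleftrightarrow> (x $ 1)\<^sup>2 + (x $ 2)\<^sup>2 \<le> 1"
  by (simp add: norm_real2)

lemma continuous_on_vector_2 [continuous_intros]:
  assumes "continuous_on S f" "continuous_on S g"
  shows "continuous_on S (\<lambda>x. vector [f x, g x] :: real^2)"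
proof -
  have "continuous_on S (\<lambda>x. \<chi> i. (vector [f x, g x] :: real^2) $ i)"
  proof (intro continuous_on_vec_lambda)
    fix i :: 2
    have "i = 1 \<or> i = 2" by (rule exhaust_2)
    then show "continuous_on S (\<lambda>x. (vector [f x, g x] :: real^2) $ i)"
      using assms by (auto simp: vector_2)
  qed
  then show ?thesis by simp
qed

text \<open>Lebesgue measure is determined by its values on boxes. Writing it as the image of a
  product measure makes Fubini's theorem available for the disk.\<close>

lemma lborel_real2:
  "(lborel :: (real^2) measure) = distr (lborel \<Otimes>\<^sub>M lborel) borel (\<lambda>(a, b). vector [a, b])"
proof (rule lborel_eqI)
  have cont: "continuous_on UNIV (\<lambda>p :: real \<times> real. vector [fst p, snd p] :: real^2)"
    by (intro continuous_intros)
  then have meas: "(\<lambda>(a, b). vector [a, b] :: real^2) \<in> (lborel \<Otimes>\<^sub>M lborel :: (real \<times> real) measure) \<rightarrow>\<^sub>M borel"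
    unfolding case_prod_beta lborel_prod by (simp add: borel_measurable_continuous_onI)
  fix l u :: "real^2"
  assume "\<And>b. b \<in> Basis \<Longrightarrow> l \<bullet> b \<le> u \<bullet> b"
  from this[of "axis 1 1"] this[of "axis 2 1"] have lu: "l $ 1 \<le> u $ 1" "l $ 2 \<le> u $ 2"
    by (auto simp: axis_in_Basis_iff inner_axis)
  have B: "(Basis :: (real^2) set) = {axis 1 1, axis 2 1}"
    by (auto simp: Basis_vec_def UNIV_2)
  have ne: "axis 1 1 \<noteq> (axis 2 1 :: real^2)" by (simp add: axis_eq_axis)
  have "(\<lambda>(a, b). vector [a, b] :: real^2) -` box l u \<inter> space (lborel \<Otimes>\<^sub>M lborel) =
      box (l $ 1) (u $ 1) \<times> box (l $ 2) (u $ 2)"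
    by (auto simp: mem_box_cart forall_2 space_pair_measure)
  then have "emeasure (distr (lborel \<Otimes>\<^sub>M lborel) borel (\<lambda>(a, b). vector [a, b])) (box l u) =
      emeasure (lborel \<Otimes>\<^sub>M lborel) (box (l $ 1) (u $ 1) \<times> box (l $ 2) (u $ 2))"
    by (subst emeasure_distr[OF meas]) auto
  also have "\<dots> = ennreal (u $ 1 - l $ 1) * ennreal (u $ 2 - l $ 2)"
    using lu by (subst lborel.emeasure_pair_measure_Times) auto
  also have "\<dots> = (\<Prod>b\<in>Basis. (u - l) \<bullet> b)"
    using lu by (simp add: B ne inner_axis ennreal_mult)
  finally show "emeasure (distr (lborel \<Otimes>\<^sub>M lborel) borel (\<lambda>(a, b). vector [a, b])) (box l u) =
      (\<Prod>b\<in>Basis. (u - l) \<bullet> b)" .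
qed simp

text \<open>Fubini's theorem along the chords with first coordinate \<open>s\<close>. Each chord is
  rescaled to \<open>{-1..1}\<close>, with its half-length as Jacobian, to match the parameter
  \<open>t\<close> of \<open>cavg_sphere\<close>.\<close>

lemma disk_integral_chords:
  fixes f :: "real^2 \<Rightarrow> real"
  assumes f: "continuous_on UNIV f"
  shows "((\<lambda>s. sqrt (1 - s\<^sup>2) * integral {-1..1} (\<lambda>t. f (vector [s, sqrt (1 - s\<^sup>2) * t]))) has_integral
     (LINT x:disk|lborel. f x)) {-1..1}"
proof -
  define h where "h = (\<lambda>x. indicator disk x *\<^sub>R f x)"
  define F where "F = (\<lambda>s. sqrt (1 - s\<^sup>2) * integral {-1..1} (\<lambda>t. f (vector [s, sqrt (1 - s\<^sup>2) * t])))"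
  have "continuous_on UNIV (\<lambda>p :: real \<times> real. vector [fst p, snd p] :: real^2)"
    by (intro continuous_intros)
  then have meas [measurable]: "(\<lambda>(a, b). vector [a, b] :: real^2) \<in> (lborel \<Otimes>\<^sub>M lborel :: (real \<times> real) measure) \<rightarrow>\<^sub>M borel"
    unfolding case_prod_beta lborel_prod by (simp add: borel_measurable_continuous_onI)
  have h: "integrable lborel h"
    using set_integrable_disk[OF continuous_on_subset[OF f]] by (simp add: h_def set_integrable_def)
  then have hm [measurable]: "h \<in> borel_measurable borel" by (simp add: borel_measurable_integrable)
  have int: "integrable (lborel \<Otimes>\<^sub>M lborel) (\<lambda>p. h (case p of (a, b) \<Rightarrow> vector [a, b]))"
    using h by (subst (asm) lborel_real2, subst (asm) integrable_distr_eq) auto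
  have eq: "(LINT x:disk|lborel. f x) = (\<integral>p. h (case p of (a, b) \<Rightarrow> vector [a, b]) \<partial>(lborel \<Otimes>\<^sub>M lborel))"
    unfolding set_lebesgue_integral_def h_def[symmetric]
    by (subst lborel_real2, subst integral_distr) auto
  have inner: "(\<integral>b. h (vector [a, b]) \<partial>lborel) = indicator {-1..1} a *\<^sub>R F a" for a
  proof (cases "\<bar>a\<bar> \<le> 1")
    case True
    define r where "r = sqrt (1 - a\<^sup>2)"
    have r: "0 \<le> r" "r\<^sup>2 = 1 - a\<^sup>2" using True by (auto simp: r_def abs_square_le_1)
    have ind: "indicator disk (vector [a, b] :: real^2) = (indicator {-r..r} b :: real)" for b
    proof -
      have "a\<^sup>2 + b\<^sup>2 \<le> 1 \<longleftrightarrow> b\<^sup>2 \<le> r\<^sup>2" using r by auto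
      also have "\<dots> \<longleftrightarrow> \<bar>b\<bar> \<le> r" using r abs_le_square_iff[of b r] by simp
      also have "\<dots> \<longleftrightarrow> b \<in> {-r..r}" by auto
      finally show ?thesis by (simp add: indicator_def norm_real2)
    qed
    have c: "continuous_on S (\<lambda>b. f (vector [a, b]))" for S
      by (rule continuous_on_compose2[OF f]) (auto intro!: continuous_intros)
    have si: "set_integrable lborel {-r..r} (\<lambda>b. f (vector [a, b]))"
      unfolding set_integrable_def by (intro borel_integrable_compact c) auto
    have "(\<integral>b. h (vector [a, b]) \<partial>lborel) = (LINT b:{-r..r}|lborel. f (vector [a, b]))"
      unfolding set_lebesgue_integral_def h_def ind ..
    also have "\<dots> = integral {-r..r} (\<lambda>b. f (vector [a, b]))"
      by (rule set_borel_integral_eq_integral(2)[OF si])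
    also have "\<dots> = r * integral {-1..1} (\<lambda>t. f (vector [a, r * t]))"
    proof -
      have "((\<lambda>t. r *\<^sub>R f (vector [a, r * t])) has_integral
          (integral {r * (-1)..r * 1} (\<lambda>b. f (vector [a, b])))) {-1..1}"
        by (rule has_integral_substitution[of _ _ _ "-r" r])
          (use r mult_left_mono[of "-1" _ r] mult_left_mono[of _ 1 r] in \<open>auto intro!: c derivative_eq_intros\<close>)
      then have "integral {-1..1} (\<lambda>t. r *\<^sub>R f (vector [a, r * t])) = integral {r * (-1)..r * 1} (\<lambda>b. f (vector [a, b]))"
        by (rule integral_unique)
      then show ?thesis by simp
    qed
    finally show ?thesis using True by (simp add: F_def r_def abs_le_iff)
  next
    case False
    then have "\<not> a\<^sup>2 \<le> 1" by (simp add: abs_square_le_1)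
    then have "\<not> a\<^sup>2 + b\<^sup>2 \<le> 1" for b using zero_le_power2[of b] by linarith
    then have "h (vector [a, b]) = 0" for b by (simp add: h_def indicator_def norm_real2)
    then show ?thesis using False by (auto simp: indicator_def)
  qed
  have "integrable lborel (\<lambda>a. indicator {-1..1} a *\<^sub>R F a)"
    using lborel_pair.integrable_fst'[OF int] by (simp add: inner)
  then have si: "set_integrable lborel {-1..1} F" by (simp add: set_integrable_def)
  have "(\<integral>p. h (case p of (a, b) \<Rightarrow> vector [a, b]) \<partial>(lborel \<Otimes>\<^sub>M lborel)) = (LINT a:{-1..1}|lborel. F a)"
    unfolding lborel_pair.integral_fst'[OF int, symmetric] by (simp add: set_lebesgue_integral_def inner)
  with eq have "(LINT x:disk|lborel. f x) = (LINT a:{-1..1}|lborel. F a)" by (rule trans)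
  then have "(F has_integral (LINT x:disk|lborel. f x)) {-1..1}"
    using set_borel_integral_eq_integral[OF si] by (simp add: has_integral_integrable_integral)
  then show ?thesis by (simp only: F_def)
qed

lemma disk_integral_orthogonal:
  fixes f :: "real^2 \<Rightarrow> real"
  assumes f: "continuous_on UNIV f" and R: "orthogonal_transformation R"
  shows "(LINT x:disk|lborel. f (R x)) = (LINT x:disk|lborel. f x)"
proof -
  have lin: "linear R" using R by (rule orthogonal_transformation_linear)
  have img: "R ` disk = disk" using image_orthogonal_transformation_cball[OF R, of 0 1] linear_0[OF lin] by simp
  have fR: "continuous_on UNIV (\<lambda>x. f (R x))"
    using lin by (intro continuous_on_compose2[OF f] linear_continuous_on) (auto simp: linear_conv_bounded_linear)
  have ai: "g absolutely_integrable_on disk" if "continuous_on UNIV g" for g :: "real^2 \<Rightarrow> real"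
    unfolding absolutely_integrable_on_def
    using that by (intro conjI set_borel_integral_eq_integral(1) set_integrable_disk continuous_intros)
      (auto intro: continuous_on_subset)
  \<comment> \<open>\<open>integral_change_of_variables_linear\<close> concerns vector-valued
    functions, so \<open>f\<close> is wrapped as a map into \<open>real^1\<close>.\<close>
  define g where "g = (\<lambda>x. vec (f x) :: real^1)"
  have "g absolutely_integrable_on disk"
    using ai[OF f] by (simp add: absolutely_integrable_on_1_iff g_def)
  then have "integral (R ` disk) g = \<bar>det (matrix R)\<bar> *\<^sub>R integral disk (g \<circ> R)"
    using img by (intro integral_change_of_variables_linear[OF lin]) simp
  moreover have "\<bar>det (matrix R)\<bar> = 1" using R by simp
  ultimately have "integral disk f = integral disk (\<lambda>x. f (R x))"
    by (simp add: img integral_on_1_eq g_def vec_eq_iff)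
  then show ?thesis
    using set_borel_integral_eq_integral(2)[OF set_integrable_disk[OF continuous_on_subset[OF f]]]
      set_borel_integral_eq_integral(2)[OF set_integrable_disk[OF continuous_on_subset[OF fR]]] by simp
qed

subsection \<open>The kernel as an average over circles\<close>

lemma poly_space_monomial:
  assumes "i + j \<le> n"
  shows "(\<lambda>x. (x $ 1) ^ i * (x $ 2) ^ j) \<in> poly_space n"
proof -
  have "(x $ 1) ^ i * (x $ 2) ^ j =
      (\<Sum>k\<le>n. \<Sum>l\<le>n - k. (if k = i then if l = j then 1 else 0 else 0) * (x $ 1) ^ k * (x $ 2) ^ l)" for x :: "real^2"
  proof -
    have "(\<Sum>k\<le>n. \<Sum>l\<le>n - k. (if k = i then if l = j then 1 else 0 else 0) * (x $ 1) ^ k * (x $ 2) ^ l) =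
        (\<Sum>k\<le>n. if k = i then (\<Sum>l\<le>n - i. if l = j then (x $ 1) ^ i * (x $ 2) ^ j else 0) else 0)"
    proof (intro sum.cong refl)
      fix k
      have "(\<Sum>l\<le>n - i. (if l = j then 1 else 0) * (x $ 1) ^ i * (x $ 2) ^ l) =
          (\<Sum>l\<le>n - i. if l = j then (x $ 1) ^ i * (x $ 2) ^ j else 0)"
        by (intro sum.cong refl) simp
      then show "(\<Sum>l\<le>n - k. (if k = i then if l = j then 1 else 0 else 0) * (x $ 1) ^ k * (x $ 2) ^ l) =
          (if k = i then (\<Sum>l\<le>n - i. if l = j then (x $ 1) ^ i * (x $ 2) ^ j else 0) else 0)"
        by (cases "k = i") simp_all
    qed
    also have "\<dots> = (x $ 1) ^ i * (x $ 2) ^ j" using assms by simp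
    finally show ?thesis ..
  qed
  then show ?thesis unfolding poly_space_def
    by (intro CollectI exI[of _ "\<lambda>k l. if k = i then if l = j then 1 else 0 else 0"]) blast
qed

lemma poly_space_const: "(\<lambda>x. c) \<in> poly_space n"
  using poly_space_lin[OF poly_space_monomial[of 0 0 n] poly_space_monomial[of 0 0 n], of c 0] by simp

lemma poly_space_add: "f \<in> poly_space n \<Longrightarrow> g \<in> poly_space n \<Longrightarrow> (\<lambda>x. f x + g x) \<in> poly_space n"
  using poly_space_lin[of f n g 1 1] by simp

lemma poly_space_cmult: "f \<in> poly_space n \<Longrightarrow> (\<lambda>x. c * f x) \<in> poly_space n"
  using poly_space_lin[of f n f c 0] by simp

lemma poly_space_sum_fun:
  assumes "\<And>i. i \<in> I \<Longrightarrow> f i \<in> poly_space n"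
  shows "(\<lambda>x. \<Sum>i\<in>I. f i x) \<in> poly_space n"
  using assms
proof (induction I rule: infinite_finite_induct)
  case (insert i I)
  then show ?case using poly_space_add[of "f i" n "\<lambda>x. \<Sum>i\<in>I. f i x"] by simp
qed (simp_all add: poly_space_const)

lemma poly_space_mult:
  assumes "f \<in> poly_space a" "g \<in> poly_space b"
  shows "(\<lambda>x. f x * g x) \<in> poly_space (a + b)"
proof -
  obtain c where c: "\<And>x. f x = (\<Sum>i\<le>a. \<Sum>j\<le>a - i. c i j * (x $ 1) ^ i * (x $ 2) ^ j)"
    using assms(1) unfolding poly_space_def by blast
  obtain d where d: "\<And>x. g x = (\<Sum>i\<le>b. \<Sum>j\<le>b - i. d i j * (x $ 1) ^ i * (x $ 2) ^ j)"
    using assms(2) unfolding poly_space_def by blast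
  have mono: "(\<lambda>x. (d k l * c i j) * ((x $ 1) ^ (i + k) * (x $ 2) ^ (j + l))) \<in> poly_space (a + b)"
    if "i \<le> a" "j \<le> a - i" "k \<le> b" "l \<le> b - k" for i j k l
    using that by (intro poly_space_cmult poly_space_monomial) auto
  have e: "f x * g x = (\<Sum>i\<le>a. \<Sum>j\<le>a - i. \<Sum>k\<le>b. \<Sum>l\<le>b - k.
      (d k l * c i j) * ((x $ 1) ^ (i + k) * (x $ 2) ^ (j + l)))" for x
    unfolding c d sum_distrib_right unfolding sum_distrib_left by (simp add: power_add mult_ac)
  show ?thesis
    unfolding e by (intro poly_space_sum_fun mono) auto
qed

lemma poly_space_mono: "f \<in> poly_space m \<Longrightarrow> m \<le> n \<Longrightarrow> f \<in> poly_space n"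
  using poly_space_mult[of f m "\<lambda>x. 1" "n - m"] poly_space_const[of 1 "n - m"] by simp

lemma poly_space_power: "f \<in> poly_space m \<Longrightarrow> (\<lambda>x. f x ^ k) \<in> poly_space (k * m)"
proof (induction k)
  case (Suc k)
  then show ?case using poly_space_mult[of f m "\<lambda>x. f x ^ k" "k * m"] by simp
qed (simp add: poly_space_const)

lemma poly_space_inner: "(\<lambda>y. x \<bullet> y) \<in> poly_space 1"
proof -
  have "(\<lambda>y. x $ 1 * ((y $ 1) ^ 1 * (y $ 2) ^ 0) + x $ 2 * ((y $ 1) ^ 0 * (y $ 2) ^ 1)) \<in> poly_space 1"
    by (intro poly_space_add poly_space_cmult poly_space_monomial) auto
  then show ?thesis by (simp add: inner_vec_def sum_2)
qed

lemma poly_space_one_minus_norm: "(\<lambda>y. 1 - (norm y)\<^sup>2) \<in> poly_space 2"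
proof -
  have "(\<lambda>y :: real^2. 1 + ((- 1) * ((y $ 1) ^ 2 * (y $ 2) ^ 0) + (- 1) * ((y $ 1) ^ 0 * (y $ 2) ^ 2))) \<in> poly_space 2"
    by (intro poly_space_add poly_space_cmult poly_space_monomial poly_space_const) auto
  also have "(\<lambda>y :: real^2. 1 + ((- 1) * ((y $ 1) ^ 2 * (y $ 2) ^ 0) + (- 1) * ((y $ 1) ^ 0 * (y $ 2) ^ 2))) =
      (\<lambda>y. 1 - (norm y)\<^sup>2)"
    by (simp add: fun_eq_iff norm_real2)
  finally show ?thesis .
qed

text \<open>A point \<open>x\<close> of the disk lifts to the points
  \<open>(x, sqrt (1 - |x|^2) * u)\<close> of the sphere in four dimensions, with \<open>u\<close>
  on the unit circle. The average is that of \<open>p\<close> at the inner product of lifts of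
  \<open>x\<close> and \<open>y\<close>, over the angle between their circle parts.\<close>

definition disk_avg :: "real poly \<Rightarrow> real^2 \<Rightarrow> real^2 \<Rightarrow> real" where
  "disk_avg p x y = cavg p (x \<bullet> y) (sqrt ((1 - (norm x)\<^sup>2) * (1 - (norm y)\<^sup>2)))"

text \<open>
  Agrees with \<^const>\<open>disk_avg\<close> on the disk only: outside it, \<^const>\<open>sqrt\<close> may meet a negative argument.
\<close>

definition disk_avg_poly :: "real poly \<Rightarrow> real^2 \<Rightarrow> real^2 \<Rightarrow> real" where
  "disk_avg_poly p x y = (\<Sum>m\<le>degree p. coeff p m * mavg m (x \<bullet> y) ((1 - (norm x)\<^sup>2) * (1 - (norm y)\<^sup>2)))"

lemma disk_avg_eq_poly:
  assumes "x \<in> disk" "y \<in> disk"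
  shows "disk_avg p x y = disk_avg_poly p x y"
proof -
  have "(norm x)\<^sup>2 \<le> 1" "(norm y)\<^sup>2 \<le> 1" using assms by (auto simp: abs_square_le_1)
  then show ?thesis by (simp add: disk_avg_def disk_avg_poly_def cavg_eq_mavg)
qed

text \<open>In \<open>y\<close>, the term with index \<open>j\<close> has degree at most
  \<open>(m - 2 * j) + 2 * j = m\<close>, because \<open>1 - |y|^2\<close> is quadratic.\<close>

lemma disk_avg_poly_in_poly_space:
  assumes "degree p \<le> n"
  shows "disk_avg_poly p x \<in> poly_space n"
proof -
  have "(\<lambda>y. (x \<bullet> y) ^ (m - 2 * j) * ((1 - (norm x)\<^sup>2) * (1 - (norm y)\<^sup>2)) ^ j) \<in> poly_space n"
    if "m \<le> degree p" "j \<le> m div 2" for m j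
  proof -
    have "(\<lambda>y. (x \<bullet> y) ^ (m - 2 * j) * ((1 - (norm x)\<^sup>2) * (1 - (norm y)\<^sup>2)) ^ j) \<in> poly_space ((m - 2 * j) * 1 + j * 2)"
      by (intro poly_space_mult poly_space_power poly_space_inner poly_space_cmult poly_space_one_minus_norm)
    then show ?thesis by (rule poly_space_mono) (use that assms in auto)
  qed
  then have "(\<lambda>y. disk_avg_poly p x y) \<in> poly_space n"
    unfolding disk_avg_poly_def mavg_def
    by (intro poly_space_sum_fun poly_space_cmult) auto
  then show ?thesis by simp
qed

lemma disk_avg_unit: "norm x = 1 \<or> norm y = 1 \<Longrightarrow> disk_avg p x y = poly p (x \<bullet> y)"
  by (auto simp: disk_avg_def)

lemma disk_integral_cong: "(\<And>x. x \<in> disk \<Longrightarrow> f x = g x) \<Longrightarrow> (LINT x:disk|lborel. f x) = (LINT x:disk|lborel. g x)"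
  by (rule set_lebesgue_integral_cong) auto

text \<open>A Funk-Hecke formula. On each chord, \<open>cavg_sphere\<close> merges the position on
  the chord and the circle angle into one uniform variable. The product formula then separates
  \<open>x $ 1\<close> from \<open>s\<close>, and orthogonality for the semicircle weight does the
  rest.\<close>

lemma disk_avg_integral_ridge:
  assumes x: "x \<in> disk"
  shows "(LINT y:disk|lborel. disk_avg (cheb_U k) x y * poly (cheb_U m) (y $ 1)) =
    (if k = m then pi * poly (cheb_U k) (x $ 1) / real (k + 1) else 0)"
proof -
  let ?f = "\<lambda>y. disk_avg_poly (cheb_U k) x y * poly (cheb_U m) (y $ 1)"
  have c: "continuous_on UNIV ?f"
    by (intro continuous_intros poly_space_continuous[OF disk_avg_poly_in_poly_space[OF order_refl]])
  have x1: "(x $ 1)\<^sup>2 + (x $ 2)\<^sup>2 \<le> 1" using x unfolding mem_disk_iff .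
  then have x1': "\<bar>x $ 1\<bar> \<le> 1" using zero_le_power2[of "x $ 2"] abs_square_le_1[of "x $ 1"] by linarith
  have "(LINT y:disk|lborel. disk_avg (cheb_U k) x y * poly (cheb_U m) (y $ 1)) = (LINT y:disk|lborel. ?f y)"
    by (rule disk_integral_cong) (simp add: disk_avg_eq_poly[OF x])
  also have "\<dots> = integral {-1..1} (\<lambda>s. sqrt (1 - s\<^sup>2) * integral {-1..1} (\<lambda>t. ?f (vector [s, sqrt (1 - s\<^sup>2) * t])))"
    using disk_integral_chords[OF c] by (simp add: integral_unique)
  also have "\<dots> = integral {-1..1} (\<lambda>s. (2 * poly (cheb_U k) (x $ 1) / real (k + 1)) *
      (poly (cheb_U k) s * poly (cheb_U m) s * sqrt (1 - s\<^sup>2)))"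
  proof (rule integral_cong)
    fix s :: real assume s: "s \<in> {-1..1}"
    define r where "r = sqrt (1 - s\<^sup>2)"
    have s2: "s\<^sup>2 \<le> 1" using s by (simp add: abs_square_le_1 abs_le_iff)
    then have r: "r\<^sup>2 = 1 - s\<^sup>2" "0 \<le> r" by (auto simp: r_def)
    define q where "q = sqrt (1 - (norm x)\<^sup>2)"
    have q: "(x $ 2)\<^sup>2 + q\<^sup>2 = 1 - (x $ 1)\<^sup>2" using x1 by (simp add: q_def norm_real2)
    \<comment> \<open>On the chord the argument is \<open>x $ 1 * s + r * (x $ 2 * t + q * sqrt (1 -
      t^2) * cos \<phi>)\<close>. The affine map moves into the polynomial, which leaves a linear
      form on the sphere of norm \<open>sqrt (1 - (x $ 1)^2)\<close>.\<close>
    have "?f (vector [s, r * t]) = cavg (pcompose (cheb_U k) [:x $ 1 * s, r:]) (x $ 2 * t) (q * sqrt (1 - t\<^sup>2)) * poly (cheb_U m) s"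
      if "t \<in> {-1..1}" for t
    proof -
      have t2: "t\<^sup>2 \<le> 1" using that by (simp add: abs_square_le_1 abs_le_iff)
      have n: "1 - (norm (vector [s, r * t] :: real^2))\<^sup>2 = r\<^sup>2 * (1 - t\<^sup>2)"
        using r by (simp add: norm_real2 power_mult_distrib algebra_simps)
      moreover have "0 \<le> r\<^sup>2 * (1 - t\<^sup>2)" using t2 by simp
      ultimately have d: "vector [s, r * t] \<in> disk" by (subst mem_disk_iff) (simp add: norm_real2)
      have "disk_avg_poly (cheb_U k) x (vector [s, r * t]) = disk_avg (cheb_U k) x (vector [s, r * t])"
        using disk_avg_eq_poly[OF x d] by simp
      also have "\<dots> = cavg (cheb_U k) (x $ 1 * s + r * (x $ 2 * t)) (r * (q * sqrt (1 - t\<^sup>2)))"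
        unfolding disk_avg_def n using r(2) by (simp add: inner_vec_def sum_2 real_sqrt_mult q_def mult_ac)
      finally show ?thesis by (simp add: cavg_pcompose)
    qed
    then have "integral {-1..1} (\<lambda>t. ?f (vector [s, r * t])) =
      integral {-1..1} (\<lambda>t. cavg (pcompose (cheb_U k) [:x $ 1 * s, r:]) (x $ 2 * t) (q * sqrt (1 - t\<^sup>2)) * poly (cheb_U m) s)"
      by (rule integral_cong)
    also have "\<dots> = integral {-1..1} (\<lambda>t. poly (pcompose (cheb_U k) [:x $ 1 * s, r:]) (sqrt (1 - (x $ 1)\<^sup>2) * t)) * poly (cheb_U m) s"
      using integral_unique[OF cavg_sphere[of "pcompose (cheb_U k) [:x $ 1 * s, r:]" "x $ 2" q]] by (simp add: q)
    also have "integral {-1..1} (\<lambda>t. poly (pcompose (cheb_U k) [:x $ 1 * s, r:]) (sqrt (1 - (x $ 1)\<^sup>2) * t)) =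
        integral {-1..1} (\<lambda>t. poly (cheb_U k) (x $ 1 * s + sqrt (1 - (x $ 1)\<^sup>2) * sqrt (1 - s\<^sup>2) * t))"
      by (simp add: poly_pcompose r_def mult_ac)
    also have "\<dots> = 2 * (poly (cheb_U k) (x $ 1) * poly (cheb_U k) s) / real (k + 1)"
      using s x1' by (intro cheb_U_product_formula) auto
    finally show "sqrt (1 - s\<^sup>2) * integral {-1..1} (\<lambda>t. ?f (vector [s, sqrt (1 - s\<^sup>2) * t])) =
        (2 * poly (cheb_U k) (x $ 1) / real (k + 1)) * (poly (cheb_U k) s * poly (cheb_U m) s * sqrt (1 - s\<^sup>2))"
      by (simp add: r_def)
  qed
  also have "\<dots> = (2 * poly (cheb_U k) (x $ 1) / real (k + 1)) * (if k = m then pi / 2 else 0)"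
    by (simp only: integral_mult_right cheb_U_orthogonal)
  finally show ?thesis by simp
qed

lemma disk_integral_sum:
  fixes f :: "'i \<Rightarrow> real^2 \<Rightarrow> real"
  assumes "\<And>i. i \<in> I \<Longrightarrow> continuous_on disk (f i)"
  shows "(LINT y:disk|lborel. \<Sum>i\<in>I. f i y) = (\<Sum>i\<in>I. LINT y:disk|lborel. f i y)"
  unfolding set_lebesgue_integral_def
  using set_integrable_disk[OF assms] by (simp add: set_integrable_def sum_distrib_left)

lemma disk_avg_continuous:
  assumes "x \<in> disk"
  shows "continuous_on disk (disk_avg p x)"
  using poly_space_continuous[OF disk_avg_poly_in_poly_space[OF order_refl]] disk_avg_eq_poly[OF assms]
  by (metis continuous_on_cong)

lemma disk_avg_sum: "disk_avg (\<Sum>i\<in>I. p i) x y = (\<Sum>i\<in>I. disk_avg (p i) x y)"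
  by (simp add: disk_avg_def cavg_sum)

lemma disk_avg_smult: "disk_avg (smult c p) x y = c * disk_avg p x y"
  by (simp add: disk_avg_def cavg_smult)

lemma disk_avg_cheb_U_integral:
  assumes "x \<in> disk"
  shows "(LINT y:disk|lborel. disk_avg (cheb_U k) x y) = (if k = 0 then pi else 0)"
  using disk_avg_integral_ridge[OF assms, of k 0] by simp

text \<open>In the expansion of the square into the \<open>cheb_U (2 * j)\<close> only
  \<open>j = 0\<close> has a nonzero integral. The value is the same for all \<open>k\<close>, so
  the upper bound grows only linearly.\<close>

lemma disk_avg_cheb_U_square_integral:
  assumes "x \<in> disk"
  shows "(LINT y:disk|lborel. disk_avg (cheb_U k * cheb_U k) x y) = pi"
  by (simp add: cheb_U_square disk_avg_sum disk_integral_sum disk_avg_continuous[OF assms]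
      disk_avg_cheb_U_integral[OF assms] sum.delta)

lemma dirichlet_eq: "dirichlet n = (\<Sum>k\<le>n. smult (real (k + 1)) (cheb_U k))"
  by (simp add: dirichlet_def of_nat_poly)

text \<open>The weights \<open>k + 1\<close> in \<open>dirichlet\<close> cancel the denominators in
  \<open>disk_avg_integral_ridge\<close>.\<close>

lemma disk_avg_dirichlet_ridge:
  assumes x: "x \<in> disk" and q: "degree q \<le> n"
  shows "(LINT y:disk|lborel. disk_avg (dirichlet n) x y * poly q (y $ 1)) = pi * poly q (x $ 1)"
proof -
  obtain c where c: "q = (\<Sum>m\<le>n. smult (c m) (cheb_U m))" using cheb_U_span[OF q] by blast
  have "(LINT y:disk|lborel. disk_avg (dirichlet n) x y * poly q (y $ 1)) =
      (LINT y:disk|lborel. \<Sum>k\<le>n. \<Sum>m\<le>n. (real (k + 1) * c m) * (disk_avg (cheb_U k) x y * poly (cheb_U m) (y $ 1)))"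
    unfolding c by (simp add: dirichlet_eq disk_avg_sum disk_avg_smult poly_sum sum_product mult.assoc mult.left_commute)
  also have "\<dots> = (\<Sum>k\<le>n. \<Sum>m\<le>n. (real (k + 1) * c m) * (LINT y:disk|lborel. disk_avg (cheb_U k) x y * poly (cheb_U m) (y $ 1)))"
    by (subst disk_integral_sum, (intro continuous_intros disk_avg_continuous x)[1],
        intro sum.cong refl, subst disk_integral_sum, (intro continuous_intros disk_avg_continuous x)[1]) simp
  also have "\<dots> = (\<Sum>k\<le>n. \<Sum>m\<le>n. if k = m then c k * (pi * poly (cheb_U k) (x $ 1)) else 0)"
    by (intro sum.cong refl) (simp add: disk_avg_integral_ridge[OF x])
  also have "\<dots> = pi * poly q (x $ 1)"
    by (simp add: c poly_sum sum_distrib_left mult_ac)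
  finally show ?thesis .
qed

subsection \<open>The reproducing property and the upper bound\<close>

lemma disk_avg_poly_orthogonal:
  assumes "orthogonal_transformation R"
  shows "disk_avg_poly p (R x) (R y) = disk_avg_poly p x y"
  using assms by (simp add: disk_avg_poly_def orthogonal_transformation_def orthogonal_transformation_norm)

text \<open>The rotation \<open>R\<close> carries the first axis to the direction of
  \<open>(1, t)\<close>, with \<open>c\<close> normalising that vector. The disk integral and
  \<open>disk_avg_poly\<close> are invariant under \<open>R\<close>, so the claim reduces to
  functions of the first coordinate.\<close>

lemma disk_avg_dirichlet_power:
  assumes x: "x \<in> disk" and m: "m \<le> n"
  shows "(LINT y:disk|lborel. disk_avg (dirichlet n) x y * (y $ 1 + t * y $ 2) ^ m) = pi * (x $ 1 + t * x $ 2) ^ m"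
proof -
  define c where "c = 1 / sqrt (1 + t\<^sup>2)"
  have c0: "c > 0" by (simp add: c_def add_pos_nonneg)
  have c2: "c\<^sup>2 * (1 + t\<^sup>2) = 1" by (simp add: c_def power_divide add_pos_nonneg less_imp_neq[symmetric])
  define R :: "real^2 \<Rightarrow> real^2" where "R = (\<lambda>y. vector [c * (y $ 1 - t * y $ 2), c * (t * y $ 1 + y $ 2)])"
  have "linear R"
    by (rule linearI) (auto simp: R_def vec_eq_iff forall_2 algebra_simps)
  moreover have "R v \<bullet> R u = v \<bullet> u" for u v
  proof -
    have "R v \<bullet> R u = (c\<^sup>2 * (1 + t\<^sup>2)) * (v \<bullet> u)"
      by (simp add: R_def inner_vec_def sum_2 power2_eq_square algebra_simps)
    then show ?thesis by (simp add: c2)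
  qed
  ultimately have R: "orthogonal_transformation R" by (simp add: orthogonal_transformation_def)
  have ridge: "(R y) $ 1 + t * (R y) $ 2 = y $ 1 / c" for y
  proof -
    have "c * ((R y) $ 1 + t * (R y) $ 2) = (c\<^sup>2 * (1 + t\<^sup>2)) * y $ 1"
      by (simp add: R_def power2_eq_square algebra_simps)
    then show ?thesis using c0 by (simp add: c2 field_simps)
  qed
  obtain x' where x': "x = R x'" using orthogonal_transformation_surj[OF R] by (metis surjD)
  have x'd: "x' \<in> disk" using x orthogonal_transformation_norm[OF R, of x'] by (simp add: x')
  let ?f = "\<lambda>y. disk_avg_poly (dirichlet n) x y * (y $ 1 + t * y $ 2) ^ m"
  have cont: "continuous_on UNIV ?f"
    by (intro continuous_intros poly_space_continuous[OF disk_avg_poly_in_poly_space[OF order_refl]])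
  have "(LINT y:disk|lborel. disk_avg (dirichlet n) x y * (y $ 1 + t * y $ 2) ^ m) = (LINT y:disk|lborel. ?f y)"
    by (rule disk_integral_cong) (simp add: disk_avg_eq_poly[OF x])
  also have "\<dots> = (LINT y:disk|lborel. ?f (R y))"
    by (rule disk_integral_orthogonal[OF cont R, symmetric])
  also have "\<dots> = (LINT y:disk|lborel. disk_avg (dirichlet n) x' y * poly (monom ((1 / c) ^ m) m) (y $ 1))"
    by (rule disk_integral_cong)
      (simp add: disk_avg_eq_poly[OF x'd] ridge x' disk_avg_poly_orthogonal[OF R] poly_monom power_divide)
  also have "\<dots> = pi * poly (monom ((1 / c) ^ m) m) (x' $ 1)"
    by (rule disk_avg_dirichlet_ridge[OF x'd]) (use m degree_monom_le order.trans in blast)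
  also have "\<dots> = pi * (x $ 1 + t * x $ 2) ^ m"
    unfolding x' ridge by (simp add: poly_monom power_divide)
  finally show ?thesis .
qed

text \<open>The reproducing property for all powers of \<open>y\<^sub>1 + t y\<^sub>2\<close> is an identity of polynomials in \<open>t\<close>; compare coefficients.\<close>

lemma disk_avg_dirichlet_monomial:
  assumes x: "x \<in> disk" and "i + j \<le> n"
  shows "(LINT y:disk|lborel. disk_avg (dirichlet n) x y * ((y $ 1) ^ i * (y $ 2) ^ j)) =
    pi * ((x $ 1) ^ i * (x $ 2) ^ j)"
proof -
  define m where "m = i + j"
  \<comment> \<open>\<open>L k\<close> is the defect of the reproducing identity at the
    \<open>k\<close>-th monomial, and \<open>q\<close> gathers these defects into a polynomial in
    \<open>t\<close>.\<close>
  define L where "L k = (LINT y:disk|lborel. disk_avg (dirichlet n) x y * ((y $ 1) ^ (m - k) * (y $ 2) ^ k))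
    - pi * ((x $ 1) ^ (m - k) * (x $ 2) ^ k)" for k
  define q where "q = (\<Sum>k\<le>m. monom (real (m choose k) * L k) k)"
  have expand: "(u + t * v) ^ m = (\<Sum>k\<le>m. (real (m choose k) * t ^ k) * (u ^ (m - k) * v ^ k))" for t u v :: real
    by (subst add.commute) (simp add: binomial_ring power_mult_distrib mult_ac)
  have "poly q t = 0" for t
  proof -
    have "(LINT y:disk|lborel. disk_avg (dirichlet n) x y * (y $ 1 + t * y $ 2) ^ m) =
      (LINT y:disk|lborel. \<Sum>k\<le>m. (real (m choose k) * t ^ k) * (disk_avg (dirichlet n) x y * ((y $ 1) ^ (m - k) * (y $ 2) ^ k)))"
      unfolding expand sum_distrib_left by (simp add: mult_ac)
    also have "\<dots> = (\<Sum>k\<le>m. (real (m choose k) * t ^ k) *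
        (LINT y:disk|lborel. disk_avg (dirichlet n) x y * ((y $ 1) ^ (m - k) * (y $ 2) ^ k)))"
      by (subst disk_integral_sum, (intro continuous_intros disk_avg_continuous x)[1]) simp
    also have "\<dots> = (\<Sum>k\<le>m. (real (m choose k) * t ^ k) * (L k + pi * ((x $ 1) ^ (m - k) * (x $ 2) ^ k)))"
      by (simp add: L_def)
    also have "\<dots> = poly q t + pi * (x $ 1 + t * x $ 2) ^ m"
      unfolding expand by (simp add: q_def poly_sum poly_monom sum_distrib_left distrib_left sum.distrib mult_ac)
    finally show ?thesis using disk_avg_dirichlet_power[OF x, of m n t] assms(2) by (simp add: m_def)
  qed
  then have "q = 0" using poly_all_0_iff_0 by blast
  then have "coeff q j = 0" by simp
  moreover have "coeff q j = real (m choose j) * L j"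
    by (simp add: q_def coeff_sum m_def)
  ultimately have "L j = 0" by (simp add: m_def)
  then show ?thesis by (simp add: L_def m_def)
qed

lemma disk_avg_dirichlet_reproducing:
  assumes x: "x \<in> disk" and f: "f \<in> poly_space n"
  shows "(LINT y:disk|lborel. disk_avg (dirichlet n) x y * f y) = pi * f x"
proof -
  obtain c where c: "\<And>x. f x = (\<Sum>i\<le>n. \<Sum>j\<le>n - i. c i j * (x $ 1) ^ i * (x $ 2) ^ j)"
    using f unfolding poly_space_def by blast
  have "(LINT y:disk|lborel. disk_avg (dirichlet n) x y * f y) =
    (LINT y:disk|lborel. \<Sum>i\<le>n. \<Sum>j\<le>n - i. c i j * (disk_avg (dirichlet n) x y * ((y $ 1) ^ i * (y $ 2) ^ j)))"
    unfolding c sum_distrib_left by (simp add: mult_ac)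
  also have "\<dots> = (\<Sum>i\<le>n. \<Sum>j\<le>n - i. c i j * (LINT y:disk|lborel. disk_avg (dirichlet n) x y * ((y $ 1) ^ i * (y $ 2) ^ j)))"
    by (subst disk_integral_sum, (intro continuous_intros disk_avg_continuous x)[1],
        intro sum.cong refl, subst disk_integral_sum, (intro continuous_intros disk_avg_continuous x)[1]) simp
  also have "\<dots> = (\<Sum>i\<le>n. \<Sum>j\<le>n - i. c i j * (pi * ((x $ 1) ^ i * (x $ 2) ^ j)))"
    by (intro sum.cong refl) (subst disk_avg_dirichlet_monomial[OF x], auto)
  also have "\<dots> = pi * f x"
    unfolding c sum_distrib_left by (simp add: mult_ac)
  finally show ?thesis .
qed

text \<open>As a function of \<open>y\<close> the average is a polynomial of degree at most
  \<open>n\<close>. By the reproducing property its coefficients in an orthonormal basis are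
  \<open>pi * p x\<close>.\<close>

lemma repro_kernel_disk:
  assumes x: "x \<in> disk" and y: "y \<in> disk"
  shows "repro_kernel n x y = disk_avg (dirichlet n) x y / pi"
proof -
  obtain P where P: "orthonormal_basis n P" using orthonormal_basis_exists by blast
  let ?Q = "disk_avg_poly (dirichlet n) x"
  have "?Q y = (\<Sum>p\<in>P. disk_inner ?Q p * p y)"
    by (rule orthonormal_expansion[OF P disk_avg_poly_in_poly_space[OF degree_dirichlet]])
  also have "\<dots> = (\<Sum>p\<in>P. (pi * p x) * p y)"
  proof (intro sum.cong refl)
    fix p assume "p \<in> P"
    then have p: "p \<in> poly_space n" using P unfolding orthonormal_basis_def by blast
    have "disk_inner ?Q p = (LINT y:disk|lborel. disk_avg (dirichlet n) x y * p y)"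
      unfolding disk_inner_def by (rule disk_integral_cong) (simp add: disk_avg_eq_poly[OF x])
    then show "disk_inner ?Q p * p y = (pi * p x) * p y"
      using disk_avg_dirichlet_reproducing[OF x p] by simp
  qed
  also have "\<dots> = pi * repro_kernel n x y"
    by (simp add: repro_kernel_eq[OF P] sum_distrib_left mult.assoc)
  finally show ?thesis by (simp add: disk_avg_eq_poly[OF x y])
qed

section \<open>The Lebesgue function and its relation to the operator norm\<close>

definition lebesgue_fun :: "nat \<Rightarrow> 'i set \<Rightarrow> ('i \<Rightarrow> real) \<Rightarrow> ('i \<Rightarrow> real^2) \<Rightarrow> real^2 \<Rightarrow> real" where
  "lebesgue_fun n A w z x = (\<Sum>\<alpha>\<in>A. w \<alpha> * \<bar>repro_kernel n (z \<alpha>) x\<bar>)"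

lemma cubature_disk_avg:
  assumes "cubature N A w z" "degree p \<le> N" "x \<in> disk"
  shows "(\<Sum>\<alpha>\<in>A. w \<alpha> * disk_avg p x (z \<alpha>)) = (LINT y:disk|lborel. disk_avg p x y)"
proof -
  have "(\<Sum>\<alpha>\<in>A. w \<alpha> * disk_avg p x (z \<alpha>)) = (\<Sum>\<alpha>\<in>A. w \<alpha> * disk_avg_poly p x (z \<alpha>))"
    using assms unfolding cubature_def by (intro sum.cong refl) (simp add: disk_avg_eq_poly del: mem_cball_0)
  also have "\<dots> = (LINT y:disk|lborel. disk_avg_poly p x y)"
    using assms disk_avg_poly_in_poly_space unfolding cubature_def by blast
  also have "\<dots> = (LINT y:disk|lborel. disk_avg p x y)"
    by (rule disk_integral_cong) (simp add: disk_avg_eq_poly[OF assms(3)])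
  finally show ?thesis .
qed

lemma disk_avg_commute: "disk_avg p x y = disk_avg p y x"
  by (simp add: disk_avg_def inner_commute mult.commute)

lemma lebesgue_fun_le:
  assumes cub: "cubature (2 * n) A w z" and x: "x \<in> disk"
  shows "lebesgue_fun n A w z x \<le> 2 * real (n + 1)"
proof -
  have z: "w \<alpha> > 0" "z \<alpha> \<in> disk" if "\<alpha> \<in> A" for \<alpha>
    using cub that unfolding cubature_def by blast+
  \<comment> \<open>A majorant of the absolute kernel on the whole real line whose degree is still
    at most \<open>2 * n\<close>, so the cubature formula is exact for its average.\<close>
  let ?p = "\<Sum>k\<le>n. smult 2 (cheb_U k * cheb_U k)"
  have bound: "\<bar>poly (dirichlet n) s\<bar> \<le> poly ?p s" for s
    using abs_dirichlet_le[of n s] by (simp add: poly_sum sum_distrib_left power2_eq_square)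
  have deg: "degree (cheb_U k * cheb_U k) \<le> 2 * n" if "k \<le> n" for k
    using degree_mult_le[of "cheb_U k" "cheb_U k"] degree_cheb_U[of k] that by linarith
  have "pi * lebesgue_fun n A w z x = (\<Sum>\<alpha>\<in>A. w \<alpha> * \<bar>disk_avg (dirichlet n) x (z \<alpha>)\<bar>)"
    unfolding lebesgue_fun_def sum_distrib_left
  proof (intro sum.cong refl)
    fix \<alpha> assume "\<alpha> \<in> A"
    show "pi * (w \<alpha> * \<bar>repro_kernel n (z \<alpha>) x\<bar>) = w \<alpha> * \<bar>disk_avg (dirichlet n) x (z \<alpha>)\<bar>"
      unfolding repro_kernel_disk[OF z(2)[OF \<open>\<alpha> \<in> A\<close>] x] by (simp add: abs_divide disk_avg_commute[of _ x])
  qed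
  also have "\<dots> \<le> (\<Sum>\<alpha>\<in>A. w \<alpha> * disk_avg ?p x (z \<alpha>))"
    unfolding disk_avg_def by (intro sum_mono mult_left_mono abs_cavg_le bound less_imp_le z)
  also have "\<dots> = (\<Sum>\<alpha>\<in>A. \<Sum>k\<le>n. 2 * (w \<alpha> * disk_avg (cheb_U k * cheb_U k) x (z \<alpha>)))"
    unfolding disk_avg_sum disk_avg_smult sum_distrib_left by (intro sum.cong refl) simp
  also have "\<dots> = (\<Sum>k\<le>n. 2 * (\<Sum>\<alpha>\<in>A. w \<alpha> * disk_avg (cheb_U k * cheb_U k) x (z \<alpha>)))"
    unfolding sum_distrib_left by (rule sum.swap)
  also have "\<dots> = (\<Sum>k\<le>n. 2 * pi)"
    by (intro sum.cong refl)
      (simp only: cubature_disk_avg[OF cub deg x] disk_avg_cheb_U_square_integral[OF x] atMost_iff)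
  also have "\<dots> = pi * (2 * real (n + 1))" by simp
  finally show ?thesis by (simp only: mult_le_cancel_left_pos pi_gt_zero)
qed

text \<open>Hyperinterpolation reproduces the constant 1. In the lower bound this covers small
  \<open>n\<close>, where the integral estimate is void, and absorbs additive constants.\<close>

lemma lebesgue_fun_ge_1:
  assumes cub: "cubature (2 * n) A w z" and x: "x \<in> disk"
  shows "1 \<le> lebesgue_fun n A w z x"
proof -
  have z: "w \<alpha> > 0" "z \<alpha> \<in> disk" if "\<alpha> \<in> A" for \<alpha>
    using cub that unfolding cubature_def by blast+
  have "degree (dirichlet n) \<le> 2 * n" using degree_dirichlet[of n] by simp
  then have "pi = (\<Sum>\<alpha>\<in>A. w \<alpha> * disk_avg (dirichlet n) x (z \<alpha>))"
    using disk_avg_dirichlet_reproducing[OF x poly_space_const[of 1 n]] cubature_disk_avg[OF cub _ x]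
    by simp
  also have "\<dots> \<le> (\<Sum>\<alpha>\<in>A. w \<alpha> * \<bar>disk_avg (dirichlet n) x (z \<alpha>)\<bar>)"
    using z by (intro sum_mono mult_left_mono) (auto simp: less_imp_le)
  also have "\<dots> = (\<Sum>\<alpha>\<in>A. pi * (w \<alpha> * \<bar>repro_kernel n (z \<alpha>) x\<bar>))"
    by (intro sum.cong refl) (simp add: repro_kernel_disk[OF z(2) x] abs_divide disk_avg_commute[of _ x])
  also have "\<dots> = pi * lebesgue_fun n A w z x"
    by (simp add: lebesgue_fun_def sum_distrib_left)
  finally show ?thesis by simp
qed

lemma abs_le_disk_norm:
  assumes "continuous_on disk f" "x \<in> disk"
  shows "\<bar>f x\<bar> \<le> disk_norm f"
proof -
  have "compact ((\<lambda>x. \<bar>f x\<bar>) ` disk)"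
    using assms by (intro compact_continuous_image continuous_intros) auto
  then have "bdd_above ((\<lambda>x. \<bar>f x\<bar>) ` disk)"
    by (intro bounded_imp_bdd_above compact_imp_bounded)
  then show ?thesis unfolding disk_norm_def using assms(2) by (intro cSUP_upper)
qed

lemma disk_norm_le:
  assumes "\<And>x. x \<in> disk \<Longrightarrow> \<bar>f x\<bar> \<le> B"
  shows "disk_norm f \<le> B"
  unfolding disk_norm_def using assms by (intro cSUP_least) auto

lemma abs_hyperinterp_le:
  assumes cub: "cubature (2 * n) A w z" and f: "continuous_on disk f" "disk_norm f \<le> 1"
  shows "\<bar>hyperinterp n A w z f x\<bar> \<le> lebesgue_fun n A w z x"
proof -
  have "\<bar>hyperinterp n A w z f x\<bar> \<le> (\<Sum>\<alpha>\<in>A. \<bar>w \<alpha> * repro_kernel n (z \<alpha>) x * f (z \<alpha>)\<bar>)"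
    unfolding hyperinterp_def by (rule sum_abs)
  also have "\<dots> \<le> lebesgue_fun n A w z x"
    unfolding lebesgue_fun_def
  proof (intro sum_mono)
    fix \<alpha> assume "\<alpha> \<in> A"
    then have z: "w \<alpha> > 0" "z \<alpha> \<in> disk" using cub unfolding cubature_def by blast+
    have "\<bar>f (z \<alpha>)\<bar> \<le> 1" using abs_le_disk_norm[OF f(1) z(2)] f(2) by simp
    then show "\<bar>w \<alpha> * repro_kernel n (z \<alpha>) x * f (z \<alpha>)\<bar> \<le> w \<alpha> * \<bar>repro_kernel n (z \<alpha>) x\<bar>"
      using z(1) by (simp add: abs_mult mult_left_le)
  qed
  finally show ?thesis .
qed

lemma disk_norm_hyperinterp_le:
  assumes "cubature (2 * n) A w z" "continuous_on disk f" "disk_norm f \<le> 1"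
  shows "disk_norm (hyperinterp n A w z f) \<le> 2 * real (n + 1)"
  using abs_hyperinterp_le[OF assms] lebesgue_fun_le[OF assms(1)] by (intro disk_norm_le) (meson order.trans)

lemma lebesgue_const_le:
  assumes "cubature (2 * n) A w z"
  shows "lebesgue_const (hyperinterp n A w z) \<le> 2 * real (n + 1)"
  unfolding lebesgue_const_def
proof (rule cSup_least)
  have "continuous_on disk (\<lambda>x. 0 :: real) \<and> disk_norm (\<lambda>x. 0) \<le> 1"
    by (auto intro!: disk_norm_le)
  then show "{disk_norm (hyperinterp n A w z f) |f. continuous_on disk f \<and> disk_norm f \<le> 1} \<noteq> {}" by blast
qed (use disk_norm_hyperinterp_le[OF assms] in blast)

text \<open>Tietze's theorem extends the sign of the kernel from the finite set of nodes to a
  continuous function bounded by 1, for which the operator attains the Lebesgue function at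
  \<open>x\<close>. The sign depends on the node and not on its index, so coinciding nodes
  agree.\<close>

lemma lebesgue_fun_le_const:
  assumes cub: "cubature (2 * n) A w z" and x: "x \<in> disk"
  shows "lebesgue_fun n A w z x \<le> lebesgue_const (hyperinterp n A w z)"
proof -
  have A: "finite A" using cub by (simp add: cubature_def)
  obtain f where f: "continuous_on UNIV f" "\<And>u. u \<in> z ` A \<Longrightarrow> f u = sgn (repro_kernel n u x)"
      "\<And>u. u \<in> UNIV \<Longrightarrow> norm (f u) \<le> 1"
  proof (rule Tietze[of "z ` A" "\<lambda>u. sgn (repro_kernel n u x)" UNIV 1])
    show "continuous_on (z ` A) (\<lambda>u. sgn (repro_kernel n u x))"
      using A by (intro continuous_on_finite) simp
    show "closedin (top_of_set UNIV) (z ` A)"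
      using A by (simp add: finite_imp_closed)
    show "norm (sgn (repro_kernel n u x)) \<le> 1" for u by (simp add: sgn_real_def)
  qed auto
  have f1: "continuous_on disk f" "disk_norm f \<le> 1"
    using f continuous_on_subset[OF f(1)] by (auto intro!: disk_norm_le)
  have "lebesgue_fun n A w z x = hyperinterp n A w z f x"
    unfolding lebesgue_fun_def hyperinterp_def by (intro sum.cong refl) (simp add: f(2) abs_sgn mult.assoc)
  also have "\<dots> \<le> disk_norm (hyperinterp n A w z f)"
  proof -
    have "\<bar>hyperinterp n A w z f y\<bar> \<le> 2 * real (n + 1)" if "y \<in> disk" for y
      using abs_hyperinterp_le[OF cub f1] lebesgue_fun_le[OF cub that] by (rule order.trans)
    then have "bdd_above ((\<lambda>x. \<bar>hyperinterp n A w z f x\<bar>) ` disk)"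
      by (intro bdd_aboveI[of _ "2 * real (n + 1)"]) blast
    then have "\<bar>hyperinterp n A w z f x\<bar> \<le> disk_norm (hyperinterp n A w z f)"
      unfolding disk_norm_def using x by (intro cSUP_upper)
    then show ?thesis by simp
  qed
  also have "\<dots> \<le> lebesgue_const (hyperinterp n A w z)"
    unfolding lebesgue_const_def
  proof (rule cSup_upper)
    show "disk_norm (hyperinterp n A w z f) \<in> {disk_norm (hyperinterp n A w z f) |f. continuous_on disk f \<and> disk_norm f \<le> 1}"
      using f1 by blast
    show "bdd_above {disk_norm (hyperinterp n A w z f) |f. continuous_on disk f \<and> disk_norm f \<le> 1}"
      using disk_norm_hyperinterp_le[OF cub] by (intro bdd_aboveI[of _ "2 * real (n + 1)"]) blast
  qed
  finally show ?thesis .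
qed

subsection \<open>The lower bound\<close>

text \<open>The numerator of the closed form is
  \<open>sin (N * t) - 2 * N * sin (t / 2) * cos u\<close>. Since \<open>|cos u|\<close> is at least
  \<open>(cos u)^2\<close>, the absolute value yields to an expression with an elementary integral.
  The range of \<open>t\<close> ensures \<open>sin (t / 2) \<ge> 1 / 2\<close> and
  \<open>2 * (1 - cos t) \<le> 3\<close>.\<close>

lemma abs_dirichlet_cos_ge:
  fixes t :: real
  assumes t: "t \<in> {pi / 3..2 * pi / 3}"
  shows "(real (n + 1) * (1 + cos (real (2 * n + 3) * t)) / 2 - 1) / 3 \<le> sin t * \<bar>poly (dirichlet n) (cos t)\<bar>"
proof -
  define N where "N = real (n + 1)"
  define E where "E = real (n + 2) * sin (real (n + 1) * t) - real (n + 1) * sin (real (n + 2) * t)"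
  define u where "u = (N + 1 / 2) * t"
  have N: "0 \<le> N" by (simp add: N_def)
  have t0: "0 \<le> t" "t \<le> pi" using t pi_gt_zero by auto
  have st: "0 \<le> sin t" using t0 by (rule sin_ge_zero)
  have ct: "- (1 / 2) \<le> cos t"
    using cos_monotone_0_pi_le[of t "2 * pi / 3"] t t0 by (simp add: cos_120)
  have sh: "1 / 2 \<le> sin (t / 2)"
    using sin_monotone_2pi_le[of "pi / 6" "t / 2"] t by (simp add: sin_30)
  have "E = sin (N * t) - 2 * N * (sin (t / 2) * cos u)"
  proof -
    have 1: "sin (u + t / 2) - sin (u - t / 2) = 2 * (sin (t / 2) * cos u)"
      by (simp add: sin_add sin_diff)
    have 2: "u + t / 2 = real (n + 2) * t" "u - t / 2 = N * t"
      by (simp_all add: u_def N_def algebra_simps)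
    show ?thesis using 1 unfolding 2 by (simp add: E_def N_def algebra_simps)
  qed
  then have "2 * N * (sin (t / 2) * \<bar>cos u\<bar>) - 1 \<le> \<bar>E\<bar>"
  proof -
    assume E: "E = sin (N * t) - 2 * N * (sin (t / 2) * cos u)"
    have "\<bar>2 * N * (sin (t / 2) * cos u)\<bar> = 2 * N * (sin (t / 2) * \<bar>cos u\<bar>)"
      using N sh by (simp add: abs_mult)
    moreover have "\<bar>sin (N * t)\<bar> \<le> 1" by simp
    ultimately show ?thesis unfolding E by linarith
  qed
  moreover have "(cos u)\<^sup>2 \<le> 2 * (sin (t / 2) * \<bar>cos u\<bar>)"
  proof -
    have "(cos u)\<^sup>2 = \<bar>cos u\<bar> * \<bar>cos u\<bar>" by (simp add: power2_eq_square)
    also have "\<dots> \<le> 1 * \<bar>cos u\<bar>" by (intro mult_right_mono) auto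
    also have "\<dots> \<le> (2 * sin (t / 2)) * \<bar>cos u\<bar>" using sh by (intro mult_right_mono) auto
    finally show ?thesis by simp
  qed
  then have "N * (cos u)\<^sup>2 \<le> N * (2 * (sin (t / 2) * \<bar>cos u\<bar>))" using N by (intro mult_left_mono)
  ultimately have "N * (cos u)\<^sup>2 - 1 \<le> \<bar>E\<bar>" by simp
  also have "\<bar>E\<bar> = 2 * (1 - cos t) * (sin t * \<bar>poly (dirichlet n) (cos t)\<bar>)"
    unfolding E_def dirichlet_cos[symmetric] using st by (simp add: abs_mult)
  also have "\<dots> \<le> 3 * (sin t * \<bar>poly (dirichlet n) (cos t)\<bar>)"
    using ct st by (intro mult_right_mono) auto
  also have "(cos u)\<^sup>2 = (1 + cos (real (2 * n + 3) * t)) / 2"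
  proof -
    have "2 * u = real (2 * n + 3) * t" by (simp add: u_def N_def algebra_simps)
    then show ?thesis using cos_double_cos[of u] by simp
  qed
  finally show ?thesis by (simp add: N_def)
qed

lemma dirichlet_L1_ge:
  "(real n - 3) / 6 \<le> integral {-1/2..1/2} (\<lambda>s. \<bar>poly (dirichlet n) s\<bar>)"
proof -
  define N where "N = real (n + 1)"
  define M where "M = real (2 * n + 3)"
  let ?a = "pi / 3" and ?b = "2 * pi / 3"
  let ?D = "\<lambda>s. \<bar>poly (dirichlet n) s\<bar>"
  have ab: "?a \<le> ?b" using pi_gt_zero by simp
  have c: "cos ?a = 1 / 2" "cos ?b = - (1 / 2)" by (simp_all add: cos_60 cos_120)
  have "((\<lambda>x. - sin x *\<^sub>R ?D (cos x)) has_integral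
      (integral {cos ?a..cos ?b} ?D - integral {cos ?b..cos ?a} ?D)) {?a..?b}"
    by (rule has_integral_substitution_general[of "{}" _ _ _ "-1" 1])
      (use ab in \<open>auto intro!: continuous_intros derivative_eq_intros\<close>)
  then have "((\<lambda>x. - sin x *\<^sub>R ?D (cos x)) has_integral - integral {-1/2..1/2} ?D) {?a..?b}"
    unfolding c by simp
  from has_integral_neg[OF this]
  have I: "((\<lambda>x. sin x * ?D (cos x)) has_integral integral {-1/2..1/2} ?D) {?a..?b}" by simp
  have M: "M > 0" by (simp add: M_def)
  have "((\<lambda>t. (N * (1 + cos (M * t)) / 2 - 1) / 3) has_integral
      (N * (?b + sin (M * ?b) / M) / 2 - ?b) / 3 - (N * (?a + sin (M * ?a) / M) / 2 - ?a) / 3) {?a..?b}"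
    by (rule fundamental_theorem_of_calculus[OF ab])
      (use M in \<open>auto intro!: derivative_eq_intros simp flip: has_real_derivative_iff_has_vector_derivative\<close>)
  then have "(N * (?b + sin (M * ?b) / M) / 2 - ?b) / 3 - (N * (?a + sin (M * ?a) / M) / 2 - ?a) / 3
      \<le> integral {-1/2..1/2} ?D"
    using I by (rule has_integral_le) (use abs_dirichlet_cos_ge[of _ n] in \<open>simp add: N_def M_def\<close>)
  moreover have "(real n - 3) / 6 \<le> (N * (?b + sin (M * ?b) / M) / 2 - ?b) / 3 - (N * (?a + sin (M * ?a) / M) / 2 - ?a) / 3"
  proof -
    have "N / M \<le> 1 / 2" using M by (simp add: N_def M_def field_simps)
    have s: "- (1 / 2) \<le> N * (sin x / M)" "N * (sin x / M) \<le> 1 / 2" for x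
    proof -
      have "\<bar>N * (sin x / M)\<bar> = N / M * \<bar>sin x\<bar>" using M by (simp add: N_def abs_mult)
      also have "\<dots> \<le> N / M * 1" using M by (intro mult_left_mono) (auto simp: N_def)
      finally have "\<bar>N * (sin x / M)\<bar> \<le> 1 / 2" using \<open>N / M \<le> 1 / 2\<close> by linarith
      then show "- (1 / 2) \<le> N * (sin x / M)" "N * (sin x / M) \<le> 1 / 2" by linarith+
    qed
    have eq: "(N * (?b + sin (M * ?b) / M) / 2 - ?b) / 3 - (N * (?a + sin (M * ?a) / M) / 2 - ?a) / 3
      = (N * pi / 6 - pi / 3 + (N * (sin (M * ?b) / M) - N * (sin (M * ?a) / M)) / 2) / 3"
      by (simp add: field_simps)
    \<comment> \<open>With \<open>3 < pi < 4\<close> the main term is at least \<open>N / 6\<close>,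
      and the errors total at most \<open>4 / 9 + 1 / 6 < 4 / 6\<close>; this gives
      \<open>(N - 4) / 6 = (n - 3) / 6\<close>.\<close>
    have "N * 3 \<le> N * pi" using pi_gt3 by (intro mult_left_mono) (auto simp: N_def)
    moreover have "real n = N - 1" by (simp add: N_def)
    ultimately show ?thesis
      unfolding eq using s[of "M * ?a"] s[of "M * ?b"] pi_less_4 by argo
  qed
  ultimately show ?thesis by linarith
qed

text \<open>If \<open>y\<close> has angle \<open>\<psi>\<close> in \<open>{0..2 * pi}\<close>, the
  half turn from \<open>\<psi>\<close> to \<open>\<psi> + pi\<close> lies in
  \<open>{0..3 * pi}\<close>, which avoids periodicity arguments. On it the inner product sweeps
  \<open>{-r..r}\<close>, an interval containing \<open>{-1/2..1/2}\<close>, and the Jacobian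
  \<open>r * sin (\<phi> - \<psi>)\<close> is at most 1.\<close>

lemma circle_average_ge:
  fixes y :: "real^2"
  assumes y: "y \<in> disk" "1 / 2 \<le> norm y"
  shows "(real n - 3) / 6 \<le>
    integral {0..3 * pi} (\<lambda>\<phi>. \<bar>poly (dirichlet n) (y \<bullet> vector [cos \<phi>, sin \<phi>])\<bar>)"
proof -
  let ?D = "\<lambda>s. \<bar>poly (dirichlet n) s\<bar>"
  define r where "r = norm y"
  have r: "1 / 2 \<le> r" "r \<le> 1" using y by (auto simp: r_def)
  have "(y $ 1)\<^sup>2 + (y $ 2)\<^sup>2 = r\<^sup>2" by (simp add: r_def norm_real2)
  then have "(y $ 1 / r)\<^sup>2 + (y $ 2 / r)\<^sup>2 = 1"
    using r by (simp add: power_divide add_divide_distrib[symmetric])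
  then obtain \<psi> where psi: "0 \<le> \<psi>" "\<psi> \<le> 2 * pi" "y $ 1 / r = cos \<psi>" "y $ 2 / r = sin \<psi>"
    using sincos_total_2pi_le by metis
  have y12: "y $ 1 = r * cos \<psi>" "y $ 2 = r * sin \<psi>" using psi(3,4) r by (auto simp: field_simps)
  have ip: "y \<bullet> vector [cos \<phi>, sin \<phi>] = r * cos (\<phi> - \<psi>)" for \<phi>
    by (simp add: inner_vec_def sum_2 y12 cos_diff algebra_simps)
  have cD: "continuous_on S (\<lambda>\<phi>. ?D (r * cos (\<phi> - \<psi>)))" for S by (intro continuous_intros)
  have "((\<lambda>\<phi>. - (r * sin (\<phi> - \<psi>)) *\<^sub>R ?D (r * cos (\<phi> - \<psi>))) has_integral
      (integral {r * cos (\<psi> - \<psi>)..r * cos (\<psi> + pi - \<psi>)} ?D - integral {r * cos (\<psi> + pi - \<psi>)..r * cos (\<psi> - \<psi>)} ?D)) {\<psi>..\<psi> + pi}"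
  proof (rule has_integral_substitution_general[of "{}" _ _ _ "-r" r])
    have "- r \<le> r * cos x \<and> r * cos x \<le> r" for x
      using mult_left_mono[OF cos_ge_minus_one[of x], of r] mult_left_mono[OF cos_le_one[of x], of r] r by simp
    then show "(\<lambda>\<phi>. r * cos (\<phi> - \<psi>)) ` {\<psi>..\<psi> + pi} \<subseteq> {- r..r}" by auto
  qed (auto intro!: continuous_intros derivative_eq_intros)
  then have "((\<lambda>\<phi>. - (r * sin (\<phi> - \<psi>)) *\<^sub>R ?D (r * cos (\<phi> - \<psi>))) has_integral - integral {-r..r} ?D) {\<psi>..\<psi> + pi}"
    using r by simp
  from has_integral_neg[OF this]
  have I: "((\<lambda>\<phi>. (r * sin (\<phi> - \<psi>)) * ?D (r * cos (\<phi> - \<psi>))) has_integral integral {-r..r} ?D) {\<psi>..\<psi> + pi}"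
    by simp
  have "(real n - 3) / 6 \<le> integral {-1/2..1/2} ?D" by (rule dirichlet_L1_ge)
  also have "\<dots> \<le> integral {-r..r} ?D"
    using r by (intro integral_subset_le integrable_continuous_interval continuous_intros) auto
  also have "\<dots> \<le> integral {\<psi>..\<psi> + pi} (\<lambda>\<phi>. ?D (r * cos (\<phi> - \<psi>)))"
  proof (rule has_integral_le[OF I integrable_integral[OF integrable_continuous_interval[OF cD]]])
    fix \<phi> assume "\<phi> \<in> {\<psi>..\<psi> + pi}"
    have "r * sin (\<phi> - \<psi>) \<le> 1" using r by (meson mult_left_le sin_le_one order.trans half_gt_zero_iff less_imp_le zero_less_one)
    then show "(r * sin (\<phi> - \<psi>)) * ?D (r * cos (\<phi> - \<psi>)) \<le> ?D (r * cos (\<phi> - \<psi>))"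
      using mult_right_mono[of "r * sin (\<phi> - \<psi>)" 1 "?D (r * cos (\<phi> - \<psi>))"] by simp
  qed
  also have "\<dots> \<le> integral {0..3 * pi} (\<lambda>\<phi>. ?D (r * cos (\<phi> - \<psi>)))"
    using psi by (intro integral_subset_le integrable_continuous_interval cD) auto
  finally show ?thesis by (simp add: ip)
qed

text \<open>A quadratic whose disk integral vanishes by \<open>disk_avg_cheb_U_integral\<close>. It
  is positive near the centre and negative near the boundary, so the weights cannot concentrate at
  the centre.\<close>

lemma disk_avg_cheb_U_2: "disk_avg (cheb_U 2) 0 y = 1 - 2 * (norm y)\<^sup>2" if "y \<in> disk"
proof -
  have U2: "cheb_U 2 = smult 4 (monom 1 2) + smult (- 1) 1"
    by (simp add: numeral_2_eq_2 monom_Suc monom_0 one_pCons)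
  have n: "(norm y)\<^sup>2 \<le> 1" using that by (simp add: abs_square_le_1)
  have w2: "cos_moment 2 = 1 / 2"
    using cos_moment_Suc_Suc[of 0] by (simp add: cos_moment_0 numeral_2_eq_2)
  have mavg: "mavg 2 0 c = c / 2" for c by (simp add: mavg_def w2)
  have "cavg 1 a b = 1" for a b by (simp add: cavg_def)
  with n show ?thesis
    unfolding disk_avg_def U2 cavg_add cavg_smult cavg_monom by (simp add: mavg)
qed

text \<open>The mean-zero quadratic \<open>1 - 2 * |y|^2\<close> is at least \<open>1 / 2\<close>
  for \<open>|y| < 1 / 2\<close> and at least -1 elsewhere. If \<open>W\<close> is the outer weight,
  exactness gives \<open>0 \<ge> pi / 2 - 3 / 2 * W\<close>. Degree 2 is covered because
  \<open>n \<ge> 1\<close>.\<close>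

lemma outer_weights_ge:
  assumes cub: "cubature (2 * n) A w z" and n: "1 \<le> n"
  shows "pi / 3 \<le> (\<Sum>\<alpha>\<in>{\<alpha>\<in>A. 1 / 2 \<le> norm (z \<alpha>)}. w \<alpha>)"
proof -
  have A: "finite A" and z: "\<And>\<alpha>. \<alpha> \<in> A \<Longrightarrow> w \<alpha> > 0" "\<And>\<alpha>. \<alpha> \<in> A \<Longrightarrow> z \<alpha> \<in> disk"
    using cub unfolding cubature_def by blast+
  have 0: "(0 :: real^2) \<in> disk" by simp
  have "degree (cheb_U 2) \<le> 2 * n" using degree_cheb_U[of 2] n by linarith
  then have "(\<Sum>\<alpha>\<in>A. w \<alpha> * disk_avg (cheb_U 2) 0 (z \<alpha>)) = 0"
    using cubature_disk_avg[OF cub _ 0] disk_avg_cheb_U_integral[OF 0, of 2] by simp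
  then have sum0: "(\<Sum>\<alpha>\<in>A. w \<alpha> * (1 - 2 * (norm (z \<alpha>))\<^sup>2)) = 0"
    using disk_avg_cheb_U_2 z by simp
  have "(\<Sum>\<alpha>\<in>A. w \<alpha> * disk_avg (cheb_U 0) 0 (z \<alpha>)) = pi"
    using cubature_disk_avg[OF cub _ 0, of "cheb_U 0"] disk_avg_cheb_U_integral[OF 0, of 0] by simp
  moreover have "disk_avg (cheb_U 0) 0 y = 1" for y by (simp add: disk_avg_def cavg_def)
  ultimately have sum1: "(\<Sum>\<alpha>\<in>A. w \<alpha>) = pi" by simp
  have "(\<Sum>\<alpha>\<in>A. w \<alpha> * (1 / 2 - 3 / 2 * indicator {y. 1 / 2 \<le> norm y} (z \<alpha>))) \<le> (\<Sum>\<alpha>\<in>A. w \<alpha> * (1 - 2 * (norm (z \<alpha>))\<^sup>2))"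
  proof (intro sum_mono)
    fix \<alpha> assume a: "\<alpha> \<in> A"
    have "(norm (z \<alpha>))\<^sup>2 \<le> 1" using z(2)[OF a] by (simp add: abs_square_le_1)
    moreover have "(norm (z \<alpha>))\<^sup>2 \<le> 1 / 4" if "norm (z \<alpha>) < 1 / 2"
      using power_mono[of "norm (z \<alpha>)" "1 / 2" 2] that by (simp add: power2_eq_square)
    ultimately have "1 / 2 - 3 / 2 * indicator {y. 1 / 2 \<le> norm y} (z \<alpha>) \<le> 1 - 2 * (norm (z \<alpha>))\<^sup>2"
      by (auto simp: indicator_def)
    then show "w \<alpha> * (1 / 2 - 3 / 2 * indicator {y. 1 / 2 \<le> norm y} (z \<alpha>)) \<le> w \<alpha> * (1 - 2 * (norm (z \<alpha>))\<^sup>2)"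
      using z(1)[OF a] by (intro mult_left_mono) auto
  qed
  also have "(\<Sum>\<alpha>\<in>A. w \<alpha> * (1 / 2 - 3 / 2 * indicator {y. 1 / 2 \<le> norm y} (z \<alpha>))) =
      pi / 2 - 3 / 2 * (\<Sum>\<alpha>\<in>A. w \<alpha> * indicator {y. 1 / 2 \<le> norm y} (z \<alpha>))"
    by (simp add: right_diff_distrib sum_subtractf sum_distrib_left sum1[symmetric] sum_divide_distrib mult_ac)
  also have "(\<Sum>\<alpha>\<in>A. w \<alpha> * indicator {y. 1 / 2 \<le> norm y} (z \<alpha>)) = (\<Sum>\<alpha>\<in>{\<alpha>\<in>A. 1 / 2 \<le> norm (z \<alpha>)}. w \<alpha>)"
    by (rule sum.mono_neutral_cong_right[OF A]) (auto simp: indicator_def)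
  finally show ?thesis using sum0 by simp
qed

lemma lebesgue_const_ge:
  assumes cub: "cubature (2 * n) A w z" and n: "1 \<le> n"
  shows "real n \<le> 1000 * lebesgue_const (hyperinterp n A w z)"
proof -
  define B where "B = lebesgue_const (hyperinterp n A w z)"
  define e :: "real \<Rightarrow> real^2" where "e = (\<lambda>\<phi>. vector [cos \<phi>, sin \<phi>])"
  let ?D = "\<lambda>s. \<bar>poly (dirichlet n) s\<bar>"
  have A: "finite A" and z: "\<And>\<alpha>. \<alpha> \<in> A \<Longrightarrow> w \<alpha> > 0" "\<And>\<alpha>. \<alpha> \<in> A \<Longrightarrow> z \<alpha> \<in> disk"
    using cub unfolding cubature_def by blast+
  have e: "norm (e \<phi>) = 1" "e \<phi> \<in> disk" for \<phi> by (auto simp: e_def norm_real2)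
  have B1: "1 \<le> B"
    unfolding B_def using lebesgue_fun_ge_1[OF cub e(2)] lebesgue_fun_le_const[OF cub e(2)] by (rule order.trans)
  have cont: "continuous_on S (\<lambda>\<phi>. w \<alpha> * ?D (z \<alpha> \<bullet> e \<phi>))" for S \<alpha>
    unfolding e_def by (intro continuous_intros)
  have pointwise: "(\<Sum>\<alpha>\<in>A. w \<alpha> * ?D (z \<alpha> \<bullet> e \<phi>)) \<le> pi * B" for \<phi>
  proof -
    have "(\<Sum>\<alpha>\<in>A. w \<alpha> * ?D (z \<alpha> \<bullet> e \<phi>)) = pi * lebesgue_fun n A w z (e \<phi>)"
      unfolding lebesgue_fun_def sum_distrib_left
      by (intro sum.cong refl) (simp add: repro_kernel_disk[OF z(2) e(2)] disk_avg_unit e(1) abs_divide)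
    also have "\<dots> \<le> pi * B"
      unfolding B_def using lebesgue_fun_le_const[OF cub e(2)] by simp
    finally show ?thesis .
  qed
  let ?W = "\<Sum>\<alpha>\<in>{\<alpha>\<in>A. 1 / 2 \<le> norm (z \<alpha>)}. w \<alpha>"
  \<comment> \<open>For \<open>n > 3\<close> the estimates give \<open>n \<le> 3 + 216 * B\<close>,
    so 1000 is a generous round constant. The term \<open>- 3 * B\<close> lets
    \<open>B \<ge> 1\<close> absorb the additive 3.\<close>
  have "real n \<le> 3 + 1000 * B - 3 * B"
  proof (cases "n \<le> 3")
    case True
    then show ?thesis using B1 by simp
  next
    case False
    have "pi / 3 * ((real n - 3) / 6) \<le> ?W * ((real n - 3) / 6)"
      using False outer_weights_ge[OF cub n] by (intro mult_right_mono) auto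
    also have "\<dots> \<le> (\<Sum>\<alpha>\<in>{\<alpha>\<in>A. 1 / 2 \<le> norm (z \<alpha>)}. integral {0..3 * pi} (\<lambda>\<phi>. w \<alpha> * ?D (z \<alpha> \<bullet> e \<phi>)))"
      unfolding sum_distrib_right
    proof (intro sum_mono)
      fix \<alpha> assume "\<alpha> \<in> {\<alpha> \<in> A. 1 / 2 \<le> norm (z \<alpha>)}"
      then have a: "\<alpha> \<in> A" "1 / 2 \<le> norm (z \<alpha>)" by auto
      show "w \<alpha> * ((real n - 3) / 6) \<le> integral {0..3 * pi} (\<lambda>\<phi>. w \<alpha> * ?D (z \<alpha> \<bullet> e \<phi>))"
        using mult_left_mono[OF circle_average_ge[OF z(2)[OF a(1)] a(2), of n] less_imp_le[OF z(1)[OF a(1)]]]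
        by (simp add: e_def)
    qed
    also have "\<dots> \<le> (\<Sum>\<alpha>\<in>A. integral {0..3 * pi} (\<lambda>\<phi>. w \<alpha> * ?D (z \<alpha> \<bullet> e \<phi>)))"
      using A z(1) by (intro sum_mono2 integral_nonneg integrable_continuous_interval cont) (auto simp: less_imp_le)
    also have "\<dots> = integral {0..3 * pi} (\<lambda>\<phi>. \<Sum>\<alpha>\<in>A. w \<alpha> * ?D (z \<alpha> \<bullet> e \<phi>))"
      using A by (intro integral_sum[symmetric] integrable_continuous_interval cont)
    \<comment> \<open>The Lebesgue constant bounds the sum at every boundary point, hence also the
      integral over all of them.\<close>
    also have "\<dots> \<le> integral {0..3 * pi} (\<lambda>\<phi>. pi * B)"
      by (intro integral_le pointwise integrable_continuous_interval continuous_on_sum cont continuous_on_const)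
    also have "\<dots> = pi * (3 * pi * B)" by simp
    finally have "pi * ((real n - 3) / 18) \<le> pi * (3 * pi * B)" by simp
    then have "(real n - 3) / 18 \<le> 3 * (pi * B)"
      by (simp only: mult_le_cancel_left_pos pi_gt_zero mult.assoc)
    moreover have "pi * B \<le> 4 * B" using pi_less_4 B1 by (intro mult_right_mono) auto
    moreover define q where "q = pi * B"
    ultimately have "(real n - 3) / 18 \<le> 3 * q" "q \<le> 4 * B" by simp_all
    then show ?thesis using B1 by argo
  qed
  then show ?thesis using B1 by (simp add: B_def)
qed

theorem corollary3p6:
  shows "\<exists>b c :: real. b > 0 \<and> c > 0 \<and>
    (\<forall>(n::nat) (A :: nat set) (w :: nat \<Rightarrow> real) (z :: nat \<Rightarrow> real^2).
       n \<ge> 1 \<longrightarrow> cubature (2 * n) A w z \<longrightarrow>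
         b * real n \<le> lebesgue_const (hyperinterp n A w z) \<and>
         lebesgue_const (hyperinterp n A w z) \<le> c * real n)"
proof -
  have "1 / 1000 * real n \<le> lebesgue_const (hyperinterp n A w z) \<and>
      lebesgue_const (hyperinterp n A w z) \<le> 4 * real n"
    if "n \<ge> 1" "cubature (2 * n) A w z" for n and A :: "nat set" and w z
  proof -
    \<comment> \<open>The condition \<open>n \<ge> 1\<close> absorbs the additive constant of the
      upper bound.\<close>
    have "2 * real (n + 1) \<le> 4 * real n" using that(1) by simp
    then show ?thesis using lebesgue_const_ge[OF that(2,1)] lebesgue_const_le[OF that(2)] by linarith
  qed
  then show ?thesis by (intro exI[of _ "1 / 1000"] exI[of _ 4]) simp
qed

end
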